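(* Let $G$ be any locally compact topological group with unit element $e$, and let $\Omega\subset G$ be an open symmetric neighborhood of $e$ (i.e. $\Omega=\Omega^{-1}$). Let $z\in\Omega$ be a fixed element of infinite order, and assume that there is a natural number $N$ with $$\langle z\rangle\cap\Omega=\{z^n : -N\le n\le N\},\qquad \langle z\rangle:=\{z^n:n\in\mathbb{Z}\}.$$ Then $$\mathcal{C}^c_G(\Omega,z)=\mathcal{C}^{\#}_G(\Omega,z)=\mathcal{K}^c_G(\Omega,z)=\mathcal{K}^{\#}_G(\Omega,z)=\cos\left(\frac{\pi}{N+2}\right).$$
   Context: Locally compact groups are Hausdorff and not assumed commutative. A function $f:G\to\mathbb{C}$ on a group $G$ is positive definite, written $f\gg0$, if for all $n\in\mathbb{N}$, $x_1,\dots,x_n\in G$ and $c_1,\dots,c_n\in\mathbb{C}$ one has $\sum_{j=1}^n\sum_{k=1}^n c_j\overline{c_k}f(x_jx_k^{-1})\ge0$. $\operatorname{supp} f$ is the closed support of $f$, and $\operatorname{supp} f\Subset\Omega$ means that $\operatorname{supp} f$ is compact and contained in $\Omega$. Function classes: $\mathcal{F}^{\#}_G(\Omega):=\{f:G\to\mathbb{C} : f\gg0,\ f(e)=1,\ f(x)=0\ \forall x\notin\Omega\}$ (no continuity or measurability required); $\mathcal{F}^{c}_G(\Omega):=\{f:G\to\mathbb{C} : f\gg0,\ f(e)=1,\ f\in C(G),\ \operatorname{supp} f\Subset\Omega\}$; $\mathcal{F}^{\#\mathbb{R}}_G(\Omega)$ and $\mathcal{F}^{c\mathbb{R}}_G(\Omega)$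 are the subsets of real-valued functions in $\mathcal{F}^{\#}_G(\Omega)$ and $\mathcal{F}^{c}_G(\Omega)$, respectively. Extremal constants: $\mathcal{C}^{\#}_G(\Omega,z):=\sup\{|f(z)|:f\in\mathcal{F}^{\#}_G(\Omega)\}$, $\mathcal{C}^{c}_G(\Omega,z):=\sup\{|f(z)|:f\in\mathcal{F}^{c}_G(\Omega)\}$, $\mathcal{K}^{\#}_G(\Omega,z):=\sup\{|f(z)|:f\in\mathcal{F}^{\#\mathbb{R}}_G(\Omega)\}$, $\mathcal{K}^{c}_G(\Omega,z):=\sup\{|f(z)|:f\in\mathcal{F}^{c\mathbb{R}}_G(\Omega)\}$. *)

theory Defs
  imports "HOL-Analysis.Analysis"
begin

text \<open>
  A (not necessarily commutative) Hausdorff topological group is a type of sort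
  \<open>{topological_group_add, t2_space}\<close>. The library class writes the group operation additively
  without assuming commutativity, so \<open>e\<close>, \<open>x y\<^sup>-\<^sup>1\<close> and \<open>z\<^sup>n\<close> are rendered as \<open>0\<close>, \<open>x - y\<close>
  (which is \<open>x + (- y)\<close>) and \<open>zpow z n\<close>.
\<close>

definition zpow :: "'a::group_add \<Rightarrow> int \<Rightarrow> 'a" where
  "zpow z n = (if n \<ge> 0 then ((+) z ^^ nat n) 0 else - ((+) z ^^ nat (- n)) 0)"

definition cyclic_subgroup :: "'a::group_add \<Rightarrow> 'a set" where
  "cyclic_subgroup z = {zpow z n | n. True}"

definition infinite_order :: "'a::group_add \<Rightarrow> bool" where
  "infinite_order z \<longleftrightarrow> (\<forall>n>0. zpow z n \<noteq> 0)"

definition positive_definite :: "('a::group_add \<Rightarrow> complex) \<Rightarrow> bool" where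
  "positive_definite f \<longleftrightarrow>
     (\<forall>(n::nat) (x :: nat \<Rightarrow> 'a) (c :: nat \<Rightarrow> complex).
        (\<Sum>j=1..n. \<Sum>k=1..n. c j * cnj (c k) * f (x j - x k)) \<in> \<real>\<^sub>\<ge>\<^sub>0)"

definition closed_support :: "('a::topological_space \<Rightarrow> complex) \<Rightarrow> 'a set" where
  "closed_support f = closure {x. f x \<noteq> 0}"

definition F_sharp :: "'a::group_add set \<Rightarrow> ('a \<Rightarrow> complex) set" where
  "F_sharp \<Omega> = {f. positive_definite f \<and> f 0 = 1 \<and> (\<forall>x. x \<notin> \<Omega> \<longrightarrow> f x = 0)}"

definition F_c :: "'a::{topological_group_add, t2_space} set \<Rightarrow> ('a \<Rightarrow> complex) set" where
  "F_c \<Omega> = {f. positive_definite f \<and> f 0 = 1 \<and> continuous_on UNIV f \<and>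
                compact (closed_support f) \<and> closed_support f \<subseteq> \<Omega>}"

definition F_sharp_real :: "'a::group_add set \<Rightarrow> ('a \<Rightarrow> complex) set" where
  "F_sharp_real \<Omega> = {f \<in> F_sharp \<Omega>. \<forall>x. f x \<in> \<real>}"

definition F_c_real :: "'a::{topological_group_add, t2_space} set \<Rightarrow> ('a \<Rightarrow> complex) set" where
  "F_c_real \<Omega> = {f \<in> F_c \<Omega>. \<forall>x. f x \<in> \<real>}"

text \<open>
  The suprema are taken in the reals. The sets are bounded by \<open>1\<close>, since a positive definite
  function satisfies \<open>\<bar>f x\<bar> \<le> f 0\<close>, and are nonempty when \<open>\<Omega>\<close> is an open neighbourhood of \<open>0\<close>
  in a locally compact group.
\<close>

definition C_sharp :: "'a::group_add set \<Rightarrow> 'a \<Rightarrow> real" where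
  "C_sharp \<Omega> z = Sup {cmod (f z) | f. f \<in> F_sharp \<Omega>}"

definition C_c :: "'a::{topological_group_add, t2_space} set \<Rightarrow> 'a \<Rightarrow> real" where
  "C_c \<Omega> z = Sup {cmod (f z) | f. f \<in> F_c \<Omega>}"

definition K_sharp :: "'a::group_add set \<Rightarrow> 'a \<Rightarrow> real" where
  "K_sharp \<Omega> z = Sup {cmod (f z) | f. f \<in> F_sharp_real \<Omega>}"

definition K_c :: "'a::{topological_group_add, t2_space} set \<Rightarrow> 'a \<Rightarrow> real" where
  "K_c \<Omega> z = Sup {cmod (f z) | f. f \<in> F_c_real \<Omega>}"

end

theory Submission
  imports Defs
begin

text \<open>
  Put \<open>m = N + 2\<close>. For the upper bound, \<open>n \<mapsto> f (zpow z n)\<close> is a positive definite sequence supported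
  in \<open>[-N, N]\<close>. Its trigonometric polynomial \<open>p\<close> is nonnegative, so its values at the points
  \<open>t\<^sub>k = (2 k + 1) \<pi> / m\<close>, rotated so that the coefficient of index \<open>1\<close> becomes \<open>\<bar>f z\<bar>\<close>, can be averaged
  against the nonnegative weights \<open>cos (\<pi> / m) - cos t\<^sub>k\<close>. All coefficients except those of index \<open>0\<close>
  and \<open>\<plusminus>1\<close> cancel, and what remains is \<open>cos (\<pi> / m) - \<bar>f z\<bar> \<ge> 0\<close>.

  The bound is attained by a continuous real function
  \<open>f x = J (\<lambda>y. G (- x + y) * G y)\<close>, where \<open>J\<close> is a left Haar integral and \<open>G\<close> is the sum of the
  translates by \<open>zpow z j\<close> of a bump with very small support, with coefficients proportional to
  \<open>sin (j \<pi> / m)\<close>. Only a positive left invariant functional on nonnegative functions of compact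
  support is needed. It is obtained following Weil: the normalised covering ratios are
  approximately additive when the covering function has small support, and Tychonoff's theorem
  gives a cluster point of them.
\<close>

section \<open>Continuous functions with compact support\<close>

definition nonneg_Cc :: "('a::{topological_group_add, t2_space} \<Rightarrow> real) set" where
  "nonneg_Cc = {f. continuous_on UNIV f \<and> (\<forall>x. 0 \<le> f x) \<and> (\<exists>K. compact K \<and> (\<forall>x. x \<notin> K \<longrightarrow> f x = 0))}"

lemma nonneg_CcI:
  assumes "continuous_on UNIV f" "\<And>x. 0 \<le> f x" "compact K" "\<And>x. x \<notin> K \<Longrightarrow> f x = 0"
  shows "f \<in> nonneg_Cc"
  using assms unfolding nonneg_Cc_def by blast

lemma nonneg_CcE:
  assumes "f \<in> nonneg_Cc"
  obtains K where "continuous_on UNIV f" "\<And>x. 0 \<le> f x" "compact K" "\<And>x. x \<notin> K \<Longrightarrow> f x = 0"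
  using assms unfolding nonneg_Cc_def by blast

lemma nonneg_Cc_nonneg: "f \<in> nonneg_Cc \<Longrightarrow> 0 \<le> f x"
  by (auto simp: nonneg_Cc_def)

lemma nonneg_Cc_continuous: "f \<in> nonneg_Cc \<Longrightarrow> continuous_on UNIV f"
  by (auto simp: nonneg_Cc_def)

lemma continuous_on_uminus_group:
  fixes f :: "'b::topological_space \<Rightarrow> 'a::topological_group_add"
  shows "continuous_on S f \<Longrightarrow> continuous_on S (\<lambda>x. - f x)"
  unfolding continuous_on_def by (auto intro: tendsto_minus)

lemma continuous_on_diff_group:
  fixes f g :: "'b::topological_space \<Rightarrow> 'a::topological_group_add"
  shows "continuous_on S f \<Longrightarrow> continuous_on S g \<Longrightarrow> continuous_on S (\<lambda>x. f x - g x)"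
  unfolding diff_conv_add_uminus by (intro continuous_on_add continuous_on_uminus_group)

lemma nonneg_Cc_zero: "(\<lambda>x. 0) \<in> nonneg_Cc"
  by (rule nonneg_CcI[where K = "{}"]) auto

lemma nonneg_Cc_add:
  assumes "f \<in> nonneg_Cc" "g \<in> nonneg_Cc"
  shows "(\<lambda>x. f x + g x) \<in> nonneg_Cc"
proof -
  obtain K L where "compact K" "\<And>x. x \<notin> K \<Longrightarrow> f x = 0" "compact L" "\<And>x. x \<notin> L \<Longrightarrow> g x = 0"
    using assms by (metis nonneg_CcE)
  then show ?thesis
    using assms
    by (intro nonneg_CcI[where K = "K \<union> L"] continuous_on_add)
       (auto simp: nonneg_Cc_nonneg nonneg_Cc_continuous)
qed

lemma nonneg_Cc_mult:
  assumes "f \<in> nonneg_Cc" "continuous_on UNIV g" "\<And>x. 0 \<le> g x"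
  shows "(\<lambda>x. f x * g x) \<in> nonneg_Cc"
proof -
  obtain K where "compact K" "\<And>x. x \<notin> K \<Longrightarrow> f x = 0"
    using assms(1) by (metis nonneg_CcE)
  then show ?thesis
    using assms
    by (intro nonneg_CcI[where K = K] continuous_on_mult)
       (auto simp: nonneg_Cc_nonneg nonneg_Cc_continuous)
qed

lemma nonneg_Cc_cmult:
  assumes "f \<in> nonneg_Cc" "0 \<le> c"
  shows "(\<lambda>x. c * f x) \<in> nonneg_Cc"
  using nonneg_Cc_mult[OF assms(1), of "\<lambda>_. c"] assms(2) by (simp add: mult.commute)

lemma nonneg_Cc_translate:
  assumes "f \<in> nonneg_Cc"
  shows "(\<lambda>x. f (a + x)) \<in> nonneg_Cc"
proof -
  obtain K where f: "continuous_on UNIV f" "compact K" "\<And>x. x \<notin> K \<Longrightarrow> f x = 0"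
    using assms by (metis nonneg_CcE)
  show ?thesis
  proof (rule nonneg_CcI[where K = "(+) (- a) ` K"])
    show "continuous_on UNIV (\<lambda>x. f (a + x))"
      by (rule continuous_on_compose2[OF f(1)]) (auto intro!: continuous_intros)
    show "compact ((+) (- a) ` K)"
      by (rule compact_continuous_image) (auto intro!: continuous_intros f)
    show "f (a + x) = 0" if "x \<notin> (+) (- a) ` K" for x
      using that f(3) by (metis image_eqI minus_add_cancel)
  qed (use assms nonneg_Cc_nonneg in auto)
qed

lemma nonneg_Cc_sum:
  assumes "\<And>i. i \<in> I \<Longrightarrow> f i \<in> nonneg_Cc"
  shows "(\<lambda>x. \<Sum>i\<in>I. f i x) \<in> nonneg_Cc"
  using assms
  by (induction I rule: infinite_finite_induct) (auto simp: nonneg_Cc_zero nonneg_Cc_add)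

lemma nonneg_Cc_left_uniform:
  assumes "f \<in> nonneg_Cc" "0 < e"
  obtains V where "open V" "0 \<in> V" "\<And>x v. v \<in> V \<Longrightarrow> \<bar>f (x + v) - f x\<bar> < e"
proof -
  obtain K where f: "continuous_on UNIV f" "compact K" "\<And>x. x \<notin> K \<Longrightarrow> f x = 0"
    using assms by (metis nonneg_CcE)
  define W where "W = {(v, x). \<bar>f (x + v) - f x\<bar> < e}"
  have "W = (\<lambda>p. \<bar>f (snd p + fst p) - f (snd p)\<bar>) -` {..<e}"
    by (auto simp: W_def)
  moreover have "continuous_on UNIV (\<lambda>p::'a \<times> 'a. \<bar>f (snd p + fst p) - f (snd p)\<bar>)"
    by (intro continuous_intros continuous_on_compose2[OF f(1)]) auto
  ultimately have "open W"
    by (simp add: open_vimage)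
  moreover have "{0} \<times> K \<subseteq> W"
    using assms(2) by (auto simp: W_def)
  ultimately obtain V where V: "0 \<in> V" "open V" "V \<times> K \<subseteq> W"
    using Elementary_Topology.tube_lemma[OF f(2), of W 0] by blast
  define U where "U = V \<inter> uminus -` V"
  show ?thesis
  proof (rule that[of U])
    show "open U"
      unfolding U_def using V(2)
      by (intro open_Int open_vimage continuous_on_uminus_group continuous_intros) auto
    show "0 \<in> U" using V by (simp add: U_def)
    fix x v assume v: "v \<in> U"
    have *: "\<bar>f (y + w) - f y\<bar> < e" if "w \<in> V" "y \<in> K" for y w
      using V(3) that by (auto simp: W_def)
    consider "x \<in> K" | "x \<notin> K" "x + v \<in> K" | "x \<notin> K" "x + v \<notin> K" by blast
    then show "\<bar>f (x + v) - f x\<bar> < e"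
    proof cases
      case 1 then show ?thesis using * v by (simp add: U_def)
    next
      case 2
      have "\<bar>f (x + v + - v) - f (x + v)\<bar> < e"
        by (rule *) (use v 2 in \<open>auto simp: U_def\<close>)
      then show ?thesis by (simp add: add.assoc abs_minus_commute)
    next
      case 3 then show ?thesis using f(3) assms(2) by simp
    qed
  qed
qed

lemma nonneg_Cc_right_uniform:
  assumes "f \<in> nonneg_Cc" "0 < e"
  obtains V where "open V" "0 \<in> V" "\<And>x v. v \<in> V \<Longrightarrow> \<bar>f (v + x) - f x\<bar> < e"
proof -
  obtain K where f: "continuous_on UNIV f" "compact K" "\<And>x. x \<notin> K \<Longrightarrow> f x = 0"
    using assms by (metis nonneg_CcE)
  have "(\<lambda>x. f (- x)) \<in> nonneg_Cc"
  proof (rule nonneg_CcI[where K = "uminus ` K"])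
    show "continuous_on UNIV (\<lambda>x. f (- x))"
      by (rule continuous_on_compose2[OF f(1)]) (auto intro!: continuous_on_uminus_group continuous_intros)
    show "compact (uminus ` K)"
      by (rule compact_continuous_image) (auto intro!: continuous_on_uminus_group continuous_intros f)
    show "f (- x) = 0" if "x \<notin> uminus ` K" for x
      using that f(3) by (metis image_eqI minus_minus)
  qed (use assms nonneg_Cc_nonneg in auto)
  then obtain V where V: "open V" "0 \<in> V" "\<And>x v. v \<in> V \<Longrightarrow> \<bar>f (- (x + v)) - f (- x)\<bar> < e"
    using assms(2) by (rule nonneg_Cc_left_uniform) blast
  show ?thesis
  proof (rule that[of "uminus -` V"])
    show "open (uminus -` V)"
      using V(1) by (intro open_vimage continuous_on_uminus_group continuous_intros) auto
    show "0 \<in> uminus -` V" using V by simp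
    show "\<bar>f (v + x) - f x\<bar> < e" if "v \<in> uminus -` V" for x v
      using V(3)[of "- v" "- x"] that by (simp add: minus_add)
  qed
qed

lemma exists_bump:
  fixes V :: "'a::{topological_group_add, t2_space} set"
  assumes lc: "locally_compact_space (euclidean :: 'a topology)" and V: "open V" "0 \<in> V"
  obtains \<phi> K where "\<phi> \<in> nonneg_Cc" "\<phi> 0 = 1" "compact K" "K \<subseteq> V" "\<And>x. x \<notin> K \<Longrightarrow> \<phi> x = 0"
proof -
  have T2: "Hausdorff_space (euclidean :: 'a topology)"
    unfolding Hausdorff_space_def disjnt_def open_openin[symmetric] using hausdorff by blast
  have "neighbourhood_base_of (compactin euclidean) (euclidean :: 'a topology)"
    using lc T2 locally_compact_space_neighbourhood_base by blast
  then have "\<exists>U K. open U \<and> compact K \<and> 0 \<in> U \<and> U \<subseteq> K \<and> K \<subseteq> V"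
    unfolding neighbourhood_base_of open_openin[symmetric] compactin_euclidean_iff
    using V by (elim allE[of _ V] allE[of _ "0::'a"] impE) auto
  then obtain U K where U: "open U" "0 \<in> U" "U \<subseteq> K" "compact K" "K \<subseteq> V"
    by (elim exE conjE)
  have "completely_regular_space (euclidean :: 'a topology)"
    using lc T2 locally_compact_regular_imp_completely_regular_space by blast
  moreover have "closedin euclidean (- U)" "0 \<in> topspace euclidean - (- U)"
    using U(1,2) by (auto simp: closed_closedin[symmetric])
  ultimately obtain g :: "'a \<Rightarrow> real" where g: "continuous_map euclidean (top_of_set {0..1}) g"
      "g 0 = 0" "g ` (- U) \<subseteq> {1}"
    unfolding completely_regular_space_def by blast
  have cont: "continuous_on UNIV g" and rng: "g x \<in> {0..1}" for x
    using g(1) by (auto simp: continuous_map_in_subtopology image_subset_iff)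
  show ?thesis
  proof (rule that[of "\<lambda>x. 1 - g x" K])
    show off: "1 - g x = 0" if "x \<notin> K" for x
      using g(3) that U by force
    show "(\<lambda>x. 1 - g x) \<in> nonneg_Cc"
      by (rule nonneg_CcI[OF _ _ U(4) off]) (use cont rng in \<open>auto intro!: continuous_intros\<close>)
  qed (use g U in auto)
qed

section \<open>The invariant functional\<close>

definition translate_sum :: "('a::group_add \<Rightarrow> real) \<Rightarrow> (real \<times> 'a) list \<Rightarrow> 'a \<Rightarrow> real" where
  "translate_sum \<phi> xs y = (\<Sum>(c, x)\<leftarrow>xs. c * \<phi> (- x + y))"

definition weight :: "(real \<times> 'a) list \<Rightarrow> real" where
  "weight xs = (\<Sum>(c, x)\<leftarrow>xs. c)"

definition dominates :: "('a::group_add \<Rightarrow> real) \<Rightarrow> (real \<times> 'a) list \<Rightarrow> ('a \<Rightarrow> real) \<Rightarrow> bool" where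
  "dominates \<phi> xs f \<longleftrightarrow> (\<forall>(c, x)\<in>set xs. 0 \<le> c) \<and> (\<forall>y. f y \<le> translate_sum \<phi> xs y)"

text \<open>Weil's covering number \<open>(f : \<phi>)\<close>.\<close>

definition cover_ratio :: "('a::group_add \<Rightarrow> real) \<Rightarrow> ('a \<Rightarrow> real) \<Rightarrow> real" where
  "cover_ratio f \<phi> = Inf {weight xs | xs. dominates \<phi> xs f}"

lemma translate_sum_simps [simp]:
  "translate_sum \<phi> [] y = 0"
  "translate_sum \<phi> ((c, x) # xs) y = c * \<phi> (- x + y) + translate_sum \<phi> xs y"
  "translate_sum \<phi> (xs @ ys) y = translate_sum \<phi> xs y + translate_sum \<phi> ys y"
  by (simp_all add: translate_sum_def)

lemma weight_simps [simp]:
  "weight [] = 0" "weight ((c, x) # xs) = c + weight xs" "weight (xs @ ys) = weight xs + weight ys"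
  by (simp_all add: weight_def)

lemma weight_nonneg: "(\<forall>(c, x)\<in>set xs. 0 \<le> c) \<Longrightarrow> 0 \<le> weight xs"
  by (induction xs) auto

lemma translate_sum_scale: "translate_sum \<phi> (map (\<lambda>(c, x). (r * c, x)) xs) y = r * translate_sum \<phi> xs y"
  by (induction xs) (auto simp: algebra_simps)

lemma weight_scale: "weight (map (\<lambda>(c, x). (r * c, x)) xs) = r * weight xs"
  by (induction xs) (auto simp: algebra_simps)

lemma translate_sum_shift:
  "translate_sum \<phi> (map (\<lambda>(c, x). (c, a + x)) xs) y = translate_sum \<phi> xs (- a + y)"
proof (induction xs)
  case (Cons p xs)
  obtain c x where "p = (c, x)" by force
  with Cons show ?case
    by (simp add: minus_add add.assoc del: add_uminus_conv_diff)
qed simp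

lemma weight_shift: "weight (map (\<lambda>(c, x). (c, a + x)) xs) = weight xs"
  by (induction xs) auto

lemma translate_sum_nonneg_Cc:
  assumes "\<phi> \<in> nonneg_Cc" "\<forall>(c, x)\<in>set xs. 0 \<le> c"
  shows "translate_sum \<phi> xs \<in> nonneg_Cc"
  using assms(2)
proof (induction xs)
  case Nil then show ?case by (simp add: nonneg_Cc_zero translate_sum_def)
next
  case (Cons p xs)
  obtain c x where p: "p = (c, x)" by force
  have "translate_sum \<phi> (p # xs) = (\<lambda>y. c * \<phi> (- x + y) + translate_sum \<phi> xs y)"
    by (auto simp: p)
  then show ?case
    using Cons p assms(1) by (auto intro!: nonneg_Cc_add nonneg_Cc_cmult nonneg_Cc_translate)
qed

lemma exists_translate_sum_ge:
  assumes \<phi>: "\<phi> \<in> nonneg_Cc" "0 < \<phi> 0" and "compact K" and "continuous_on UNIV f" and f0: "\<And>y. 0 \<le> f y"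
  obtains xs where "\<forall>(c, x)\<in>set xs. 0 \<le> c" "\<And>y. y \<in> K \<Longrightarrow> f y \<le> translate_sum \<phi> xs y"
proof -
  define c where "c x = (f x + 1) / \<phi> 0" for x
  have c0: "0 \<le> c x" for x using f0[of x] \<phi>(2) by (simp add: c_def)
  define U where "U x = {y. f y < c x * \<phi> (- x + y)}" for x
  have "open (U x)" for x
    unfolding U_def using assms(4) nonneg_Cc_translate[OF \<phi>(1)]
    by (intro open_Collect_less continuous_on_mult continuous_on_const) (auto simp: nonneg_Cc_def)
  moreover have "x \<in> U x" for x using \<phi>(2) by (simp add: U_def c_def)
  ultimately obtain D where D: "finite D" "K \<subseteq> (\<Union>x\<in>D. U x)"
    using compactE_image[OF assms(3), of K U] by (metis UN_I subsetI)
  then obtain ds where ds: "set ds = D" "distinct ds" using finite_distinct_list by blast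
  show ?thesis
  proof (rule that[of "map (\<lambda>x. (c x, x)) ds"])
    fix y assume "y \<in> K"
    then obtain x where x: "x \<in> D" "y \<in> U x" using D by blast
    have "translate_sum \<phi> (map (\<lambda>x. (c x, x)) ds) y = (\<Sum>x\<in>D. c x * \<phi> (- x + y))"
      using ds by (simp add: translate_sum_def o_def sum_list_distinct_conv_sum_set)
    moreover have "c x * \<phi> (- x + y) \<le> (\<Sum>x\<in>D. c x * \<phi> (- x + y))"
      using x D c0 nonneg_Cc_nonneg[OF \<phi>(1)] by (intro member_le_sum) auto
    ultimately show "f y \<le> translate_sum \<phi> (map (\<lambda>x. (c x, x)) ds) y"
      using x by (auto simp: U_def)
  qed (use c0 in auto)
qed

lemma exists_dominates:
  assumes "\<phi> \<in> nonneg_Cc" "0 < \<phi> 0" "f \<in> nonneg_Cc"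
  obtains xs where "dominates \<phi> xs f"
proof -
  obtain K where f: "continuous_on UNIV f" "\<And>x. 0 \<le> f x" "compact K" "\<And>x. x \<notin> K \<Longrightarrow> f x = 0"
    using assms(3) by (metis nonneg_CcE)
  obtain xs where xs: "\<forall>(c, x)\<in>set xs. 0 \<le> c" "\<And>y. y \<in> K \<Longrightarrow> f y \<le> translate_sum \<phi> xs y"
    using exists_translate_sum_ge[OF assms(1,2) f(3,1,2)] by blast
  have "f y \<le> translate_sum \<phi> xs y" for y
    using xs(2) f(4) nonneg_Cc_nonneg[OF translate_sum_nonneg_Cc[OF assms(1) xs(1)]]
    by (cases "y \<in> K") auto
  with xs(1) show ?thesis by (intro that[of xs]) (simp add: dominates_def)
qed

lemma cover_ratio_le: "dominates \<phi> xs f \<Longrightarrow> cover_ratio f \<phi> \<le> weight xs"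
  unfolding cover_ratio_def
  by (rule cInf_lower) (auto intro!: bdd_belowI[of _ 0] weight_nonneg simp: dominates_def)

lemma cover_ratio_ge:
  assumes "\<phi> \<in> nonneg_Cc" "0 < \<phi> 0" "f \<in> nonneg_Cc" "\<And>xs. dominates \<phi> xs f \<Longrightarrow> r \<le> weight xs"
  shows "r \<le> cover_ratio f \<phi>"
  unfolding cover_ratio_def
  using exists_dominates[OF assms(1-3)] by (intro cInf_greatest) (auto intro: assms(4))

lemma cover_ratio_nonneg:
  assumes "\<phi> \<in> nonneg_Cc" "0 < \<phi> 0" "f \<in> nonneg_Cc"
  shows "0 \<le> cover_ratio f \<phi>"
  by (rule cover_ratio_ge[OF assms]) (simp add: dominates_def weight_nonneg)

lemma cover_ratio_approx:
  assumes "\<phi> \<in> nonneg_Cc" "0 < \<phi> 0" "f \<in> nonneg_Cc" "0 < e"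
  obtains xs where "dominates \<phi> xs f" "weight xs < cover_ratio f \<phi> + e"
proof -
  have "\<exists>xs. dominates \<phi> xs f \<and> \<not> cover_ratio f \<phi> + e \<le> weight xs"
    using cover_ratio_ge[OF assms(1-3), of "cover_ratio f \<phi> + e"] assms(4) by auto
  then show ?thesis using that by auto
qed

context
  fixes \<phi> :: "'a::{topological_group_add, t2_space} \<Rightarrow> real"
  assumes \<phi>: "\<phi> \<in> nonneg_Cc" "0 < \<phi> 0"
begin

lemma cover_ratio_mono:
  assumes "g \<in> nonneg_Cc" "\<And>y. f y \<le> g y"
  shows "cover_ratio f \<phi> \<le> cover_ratio g \<phi>"
proof (rule cover_ratio_ge[OF \<phi> assms(1)])
  fix xs assume "dominates \<phi> xs g"
  then have "dominates \<phi> xs f"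
    using assms(2) by (auto simp: dominates_def intro: order_trans)
  then show "cover_ratio f \<phi> \<le> weight xs" by (rule cover_ratio_le)
qed

lemma cover_ratio_subadd:
  assumes "f \<in> nonneg_Cc" "g \<in> nonneg_Cc"
  shows "cover_ratio (\<lambda>y. f y + g y) \<phi> \<le> cover_ratio f \<phi> + cover_ratio g \<phi>"
proof (rule field_le_epsilon)
  fix e :: real assume "0 < e"
  then obtain xs ys where "dominates \<phi> xs f" "weight xs < cover_ratio f \<phi> + e / 2"
      "dominates \<phi> ys g" "weight ys < cover_ratio g \<phi> + e / 2"
    using cover_ratio_approx[OF \<phi>, of _ "e / 2"] assms by (metis half_gt_zero)
  moreover from this have "dominates \<phi> (xs @ ys) (\<lambda>y. f y + g y)"
    by (auto simp: dominates_def intro: add_mono)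
  ultimately show "cover_ratio (\<lambda>y. f y + g y) \<phi> \<le> cover_ratio f \<phi> + cover_ratio g \<phi> + e"
    using cover_ratio_le by fastforce
qed

lemma cover_ratio_cmult_le:
  assumes "f \<in> nonneg_Cc" "0 < r"
  shows "cover_ratio (\<lambda>y. r * f y) \<phi> \<le> r * cover_ratio f \<phi>"
proof -
  have "cover_ratio (\<lambda>y. r * f y) \<phi> / r \<le> cover_ratio f \<phi>"
  proof (rule cover_ratio_ge[OF \<phi> assms(1)])
    fix xs assume "dominates \<phi> xs f"
    then have "dominates \<phi> (map (\<lambda>(c, x). (r * c, x)) xs) (\<lambda>y. r * f y)"
      using assms(2) by (auto simp: dominates_def translate_sum_scale)
    from cover_ratio_le[OF this, unfolded weight_scale]
    show "cover_ratio (\<lambda>y. r * f y) \<phi> / r \<le> weight xs"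
      using assms(2) by (simp add: field_simps)
  qed
  then show ?thesis using assms(2) by (simp add: field_simps)
qed

lemma cover_ratio_cmult:
  assumes "f \<in> nonneg_Cc" "0 < r"
  shows "cover_ratio (\<lambda>y. r * f y) \<phi> = r * cover_ratio f \<phi>"
proof (rule antisym[OF cover_ratio_cmult_le[OF assms]])
  have "cover_ratio (\<lambda>y. (1 / r) * (r * f y)) \<phi> \<le> (1 / r) * cover_ratio (\<lambda>y. r * f y) \<phi>"
    using assms by (intro cover_ratio_cmult_le nonneg_Cc_cmult) auto
  then show "r * cover_ratio f \<phi> \<le> cover_ratio (\<lambda>y. r * f y) \<phi>"
    using assms(2) by (simp add: field_simps)
qed

lemma cover_ratio_translate_le:
  assumes "f \<in> nonneg_Cc"
  shows "cover_ratio (\<lambda>y. f (a + y)) \<phi> \<le> cover_ratio f \<phi>"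
proof (rule cover_ratio_ge[OF \<phi> assms])
  fix xs assume "dominates \<phi> xs f"
  then have "dominates \<phi> (map (\<lambda>(c, x). (c, - a + x)) xs) (\<lambda>y. f (a + y))"
    by (auto simp: dominates_def translate_sum_shift)
  from cover_ratio_le[OF this] show "cover_ratio (\<lambda>y. f (a + y)) \<phi> \<le> weight xs"
    by (simp add: weight_shift)
qed

lemma cover_ratio_translate:
  assumes "f \<in> nonneg_Cc"
  shows "cover_ratio (\<lambda>y. f (a + y)) \<phi> = cover_ratio f \<phi>"
  using cover_ratio_translate_le[OF assms, of a]
    cover_ratio_translate_le[OF nonneg_Cc_translate[OF assms, of a], of "- a"]
  by simp

lemma dominates_trans:
  assumes "dominates \<psi> xs f" "dominates \<phi> ys \<psi>"
  obtains zs where "dominates \<phi> zs f" "weight zs = weight xs * weight ys"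
proof -
  have ys: "\<forall>(c, x)\<in>set ys. 0 \<le> c" "\<And>y. \<psi> y \<le> translate_sum \<phi> ys y"
    using assms(2) by (auto simp: dominates_def)
  have "\<exists>zs. (\<forall>(c, x)\<in>set zs. 0 \<le> c) \<and> weight zs = weight xs * weight ys
      \<and> (\<forall>y. translate_sum \<psi> xs y \<le> translate_sum \<phi> zs y)"
    if "\<forall>(c, x)\<in>set xs. 0 \<le> c"
    using that
  proof (induction xs)
    case Nil show ?case by (rule exI[of _ "[]"]) simp
  next
    case (Cons p xs)
    obtain c x where p: "p = (c, x)" by force
    obtain zs where zs: "\<forall>(c, x)\<in>set zs. 0 \<le> c" "weight zs = weight xs * weight ys"
        "\<And>y. translate_sum \<psi> xs y \<le> translate_sum \<phi> zs y"
      using Cons by auto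
    have "0 \<le> c" using Cons.prems p by auto
    define us where "us = map (\<lambda>(d, w). (c * d, w)) (map (\<lambda>(d, w). (d, x + w)) ys)"
    have "c * \<psi> (- x + y) \<le> translate_sum \<phi> us y" for y
      unfolding us_def translate_sum_scale translate_sum_shift
      using ys(2) \<open>0 \<le> c\<close> by (rule mult_left_mono)
    moreover have "weight us = c * weight ys"
      by (simp only: us_def weight_scale weight_shift)
    moreover have "\<forall>(c, x)\<in>set us. 0 \<le> c"
      using ys(1) \<open>0 \<le> c\<close> by (auto simp: us_def)
    ultimately show ?case
      using zs by (intro exI[of _ "us @ zs"]) (auto simp: p distrib_right intro!: add_mono)
  qed
  then obtain zs where "\<forall>(c, x)\<in>set zs. 0 \<le> c" "weight zs = weight xs * weight ys"
      "\<And>y. translate_sum \<psi> xs y \<le> translate_sum \<phi> zs y"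
    using assms(1) by (auto simp: dominates_def)
  moreover from this have "f y \<le> translate_sum \<phi> zs y" for y
    using assms(1) order_trans unfolding dominates_def by blast
  ultimately show ?thesis
    by (intro that[of zs]) (auto simp: dominates_def)
qed

lemma cover_ratio_submult:
  assumes "\<psi> \<in> nonneg_Cc" "0 < \<psi> 0" "f \<in> nonneg_Cc" "0 < cover_ratio \<psi> \<phi>" "dominates \<psi> xs f"
  shows "cover_ratio f \<phi> \<le> weight xs * cover_ratio \<psi> \<phi>"
proof (cases "weight xs = 0")
  case True
  obtain ys where "dominates \<phi> ys \<psi>" using exists_dominates[OF \<phi> assms(1)] .
  from dominates_trans[OF assms(5) this] True cover_ratio_le show ?thesis by (metis mult_zero_left)
next
  case False
  then have pos: "0 < weight xs" using assms(5) weight_nonneg[of xs] by (auto simp: dominates_def)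
  have "cover_ratio f \<phi> / weight xs \<le> cover_ratio \<psi> \<phi>"
  proof (rule cover_ratio_ge[OF \<phi> assms(1)])
    fix ys assume "dominates \<phi> ys \<psi>"
    from dominates_trans[OF assms(5) this] cover_ratio_le
    have "cover_ratio f \<phi> \<le> weight xs * weight ys" by metis
    then show "cover_ratio f \<phi> / weight xs \<le> weight ys" using pos by (simp add: field_simps)
  qed
  then show ?thesis using pos by (simp add: field_simps)
qed

lemma cover_ratio_pos:
  assumes "f \<in> nonneg_Cc" "0 < f 0"
  shows "0 < cover_ratio f \<phi>"
proof -
  obtain K where K: "compact K" "\<And>x. x \<notin> K \<Longrightarrow> \<phi> x = 0" "continuous_on UNIV \<phi>"
    using \<phi>(1) by (metis nonneg_CcE)
  then have "bounded (\<phi> ` K)"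
    by (intro compact_imp_bounded compact_continuous_image) (auto intro: continuous_on_subset)
  then obtain B where B: "\<And>x. x \<in> K \<Longrightarrow> \<phi> x \<le> B" "0 < B"
    unfolding bounded_pos by (metis abs_le_D1 image_eqI real_norm_def)
  have B': "\<phi> x \<le> B" for x using B K(2)[of x] by (cases "x \<in> K") auto
  have *: "translate_sum \<phi> xs y \<le> weight xs * B" if "\<forall>(c, x)\<in>set xs. 0 \<le> c" for xs y
    using that
  proof (induction xs)
    case (Cons p xs)
    obtain c x where p: "p = (c, x)" by force
    have "c * \<phi> (- x + y) \<le> c * B" using Cons.prems p B' by (intro mult_left_mono) auto
    then show ?case using Cons by (auto simp: p algebra_simps)
  qed simp
  have "f 0 / B \<le> cover_ratio f \<phi>"
  proof (rule cover_ratio_ge[OF \<phi> assms(1)])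
    fix xs assume "dominates \<phi> xs f"
    then have "f 0 \<le> weight xs * B" using *[of xs 0] by (auto simp: dominates_def intro: order_trans)
    then show "f 0 / B \<le> weight xs" using B by (simp add: field_simps)
  qed
  then show ?thesis using assms(2) B by (smt (verit) divide_pos_pos)
qed

end

text \<open>
  A cover of \<open>f\<^sub>1 + f\<^sub>2 + e h\<close> splits into covers of \<open>f\<^sub>1\<close> and \<open>f\<^sub>2\<close>: weight the translate at \<open>x\<close> by
  the value at \<open>x\<close> of \<open>f\<^sub>i / (f\<^sub>1 + f\<^sub>2 + e)\<close>, which varies little on the support of that translate.
  The function \<open>h\<close> is at least \<open>1\<close> on the supports of \<open>f\<^sub>1\<close> and \<open>f\<^sub>2\<close>; adding \<open>e\<close> in the denominator
  avoids division by zero.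
\<close>

lemma cover_ratio_superadd_approx:
  fixes f\<^sub>1 f\<^sub>2 g :: "'a::{topological_group_add, t2_space} \<Rightarrow> real"
  assumes f: "f\<^sub>1 \<in> nonneg_Cc" "f\<^sub>2 \<in> nonneg_Cc" and g: "g \<in> nonneg_Cc" "0 < g 0"
  obtains h where "h \<in> nonneg_Cc"
    "\<And>e. 0 < e \<Longrightarrow> \<exists>V. open V \<and> 0 \<in> V \<and> (\<forall>\<phi>\<in>nonneg_Cc. 0 < \<phi> 0 \<longrightarrow> (\<forall>x. x \<notin> V \<longrightarrow> \<phi> x = 0) \<longrightarrow>
       cover_ratio f\<^sub>1 \<phi> + cover_ratio f\<^sub>2 \<phi>
         \<le> (1 + e) * (cover_ratio (\<lambda>x. f\<^sub>1 x + f\<^sub>2 x) \<phi> + e * cover_ratio h \<phi>))"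
proof -
  obtain K\<^sub>1 K\<^sub>2 where K: "compact K\<^sub>1" "\<And>x. x \<notin> K\<^sub>1 \<Longrightarrow> f\<^sub>1 x = 0" "compact K\<^sub>2" "\<And>x. x \<notin> K\<^sub>2 \<Longrightarrow> f\<^sub>2 x = 0"
    using f by (metis nonneg_CcE)
  obtain ys where ys: "\<forall>(c, x)\<in>set ys. 0 \<le> c" "\<And>y. y \<in> K\<^sub>1 \<union> K\<^sub>2 \<Longrightarrow> 1 \<le> translate_sum g ys y"
    using exists_translate_sum_ge[OF g compact_Un[OF K(1,3)], of "\<lambda>_. 1"] by auto
  define h where "h = translate_sum g ys"
  have h: "h \<in> nonneg_Cc" unfolding h_def using g(1) ys(1) by (rule translate_sum_nonneg_Cc)
  note pos = nonneg_Cc_nonneg[OF f(1)] nonneg_Cc_nonneg[OF f(2)]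
  show ?thesis
  proof (rule that[OF h])
    fix e :: real assume e: "0 < e"
    define q where "q f x = f x / (f\<^sub>1 x + f\<^sub>2 x + e)" for f :: "'a \<Rightarrow> real" and x
    have den: "0 < f\<^sub>1 x + f\<^sub>2 x + e" for x using pos[of x] e by linarith
    have den': "f\<^sub>1 x + f\<^sub>2 x + e \<noteq> 0" for x using den[of x] by linarith
    have qP: "q f \<in> nonneg_Cc" if "f \<in> nonneg_Cc" for f
    proof -
      have "(\<lambda>x. f x * (1 / (f\<^sub>1 x + f\<^sub>2 x + e))) \<in> nonneg_Cc"
        using f den' den by (intro nonneg_Cc_mult[OF that] continuous_on_divide continuous_on_add)
          (auto simp: nonneg_Cc_continuous less_imp_le)
      then show ?thesis by (simp add: q_def[abs_def])
    qed
    have e2: "0 < e / 2" using e by simp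
    obtain V\<^sub>1 where V\<^sub>1: "open V\<^sub>1" "0 \<in> V\<^sub>1" "\<And>x v. v \<in> V\<^sub>1 \<Longrightarrow> \<bar>q f\<^sub>1 (x + v) - q f\<^sub>1 x\<bar> < e / 2"
      using nonneg_Cc_left_uniform[OF qP[OF f(1)] e2] by metis
    obtain V\<^sub>2 where V\<^sub>2: "open V\<^sub>2" "0 \<in> V\<^sub>2" "\<And>x v. v \<in> V\<^sub>2 \<Longrightarrow> \<bar>q f\<^sub>2 (x + v) - q f\<^sub>2 x\<bar> < e / 2"
      using nonneg_Cc_left_uniform[OF qP[OF f(2)] e2] by metis
    define V where "V = V\<^sub>1 \<inter> V\<^sub>2"
    have V: "\<bar>q f (x + v) - q f x\<bar> < e / 2" if "v \<in> V" "f = f\<^sub>1 \<or> f = f\<^sub>2" for f x v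
      using that V\<^sub>1(3) V\<^sub>2(3) by (auto simp: V_def)
    have main: "cover_ratio f\<^sub>1 \<phi> + cover_ratio f\<^sub>2 \<phi>
         \<le> (1 + e) * (cover_ratio (\<lambda>x. f\<^sub>1 x + f\<^sub>2 x) \<phi> + e * cover_ratio h \<phi>)"
      if \<phi>: "\<phi> \<in> nonneg_Cc" "0 < \<phi> 0" "\<forall>x. x \<notin> V \<longrightarrow> \<phi> x = 0" for \<phi>
    proof -
      define F where "F x = (f\<^sub>1 x + f\<^sub>2 x) + e * h x" for x
      have FP: "F \<in> nonneg_Cc"
        unfolding F_def using f h e by (intro nonneg_Cc_add nonneg_Cc_cmult) auto
      have "(cover_ratio f\<^sub>1 \<phi> + cover_ratio f\<^sub>2 \<phi>) / (1 + e) \<le> cover_ratio F \<phi>"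
      proof (rule cover_ratio_ge[OF \<phi>(1,2) FP])
        fix xs assume xs: "dominates \<phi> xs F"
        then have c0: "\<forall>(c, x)\<in>set xs. 0 \<le> c" by (simp add: dominates_def)
        define L where "L f = map (\<lambda>(c, x). (c * (q f x + e / 2), x)) xs" for f
        have dom: "dominates \<phi> (L f) f" if ff: "f = f\<^sub>1 \<or> f = f\<^sub>2" for f
          unfolding dominates_def
        proof (intro conjI allI)
          have q0: "0 \<le> q f x" for x using qP f ff nonneg_Cc_nonneg by blast
          show "\<forall>(c, x)\<in>set (L f). 0 \<le> c"
            using c0 q0 e by (fastforce simp: L_def intro!: mult_nonneg_nonneg add_nonneg_nonneg)
          fix y
          have "f y = (f\<^sub>1 y + f\<^sub>2 y + e) * q f y" using den'[of y] by (simp add: q_def)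
          also have "\<dots> \<le> F y * q f y"
          proof (cases "f y = 0")
            case False
            then have "1 \<le> h y" using ys(2)[of y] K(2,4) ff by (auto simp: h_def)
            then show ?thesis using e q0 by (intro mult_right_mono) (auto simp: F_def)
          qed (simp add: q_def)
          also have "\<dots> \<le> translate_sum \<phi> xs y * q f y"
            using xs q0 by (intro mult_right_mono) (auto simp: dominates_def)
          also have "\<dots> \<le> translate_sum \<phi> (L f) y"
            unfolding L_def using c0
          proof (induction xs)
            case (Cons p xs)
            obtain c x where p: "p = (c, x)" by force
            have "\<phi> (- x + y) * q f y \<le> \<phi> (- x + y) * (q f x + e / 2)"
            proof (cases "- x + y \<in> V")
              case True
              from V[OF this ff, of x] have "q f y \<le> q f x + e / 2"
                unfolding add_minus_cancel by linarith
              then show ?thesis using nonneg_Cc_nonneg[OF \<phi>(1)] by (intro mult_left_mono)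
            qed (use \<phi>(3) in simp)
            then have "c * (\<phi> (- x + y) * q f y) \<le> c * (\<phi> (- x + y) * (q f x + e / 2))"
              by (rule mult_left_mono) (use Cons.prems p in auto)
            then have "c * \<phi> (- x + y) * q f y \<le> c * (q f x + e / 2) * \<phi> (- x + y)"
              by (simp only: mult_ac)
            from add_mono[OF this Cons.IH] Cons.prems show ?case
              by (simp add: p distrib_right)
          qed simp
          finally show "f y \<le> translate_sum \<phi> (L f) y" .
        qed
        have "cover_ratio f\<^sub>1 \<phi> + cover_ratio f\<^sub>2 \<phi> \<le> weight (L f\<^sub>1) + weight (L f\<^sub>2)"
          by (intro add_mono cover_ratio_le dom) auto
        also have "\<dots> \<le> (1 + e) * weight xs"
          unfolding L_def using c0
        proof (induction xs)
          case (Cons p xs)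
          obtain c x where p: "p = (c, x)" by force
          have "q f\<^sub>1 x + q f\<^sub>2 x \<le> 1"
            unfolding q_def add_divide_distrib[symmetric] using den[of x] e by simp
          then have "c * (q f\<^sub>1 x + q f\<^sub>2 x + e) \<le> c * (1 + e)"
            using Cons.prems p by (intro mult_left_mono) auto
          with Cons show ?case by (simp add: p algebra_simps)
        qed simp
        finally show "(cover_ratio f\<^sub>1 \<phi> + cover_ratio f\<^sub>2 \<phi>) / (1 + e) \<le> weight xs"
          using e by (simp add: field_simps)
      qed
      also have "\<dots> \<le> cover_ratio (\<lambda>x. f\<^sub>1 x + f\<^sub>2 x) \<phi> + cover_ratio (\<lambda>x. e * h x) \<phi>"
        unfolding F_def using f h e
        by (intro cover_ratio_subadd[OF \<phi>(1,2)] nonneg_Cc_add nonneg_Cc_cmult) auto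
      also have "cover_ratio (\<lambda>x. e * h x) \<phi> = e * cover_ratio h \<phi>"
        using h e by (intro cover_ratio_cmult[OF \<phi>(1,2)])
      finally show ?thesis using e by (simp add: divide_le_eq mult.commute)
    qed
    show "\<exists>V. open V \<and> 0 \<in> V \<and> (\<forall>\<phi>\<in>nonneg_Cc. 0 < \<phi> 0 \<longrightarrow> (\<forall>x. x \<notin> V \<longrightarrow> \<phi> x = 0) \<longrightarrow>
       cover_ratio f\<^sub>1 \<phi> + cover_ratio f\<^sub>2 \<phi>
         \<le> (1 + e) * (cover_ratio (\<lambda>x. f\<^sub>1 x + f\<^sub>2 x) \<phi> + e * cover_ratio h \<phi>))"
      using main V\<^sub>1(1,2) V\<^sub>2(1,2) by (intro exI[of _ V]) (auto simp: V_def)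
  qed
qed

locale invariant_functional =
  fixes J :: "('a::{topological_group_add, t2_space} \<Rightarrow> real) \<Rightarrow> real"
  assumes mono: "f \<in> nonneg_Cc \<Longrightarrow> g \<in> nonneg_Cc \<Longrightarrow> (\<And>x. f x \<le> g x) \<Longrightarrow> J f \<le> J g"
    and add: "f \<in> nonneg_Cc \<Longrightarrow> g \<in> nonneg_Cc \<Longrightarrow> J (\<lambda>x. f x + g x) = J f + J g"
    and cmult_pos: "f \<in> nonneg_Cc \<Longrightarrow> 0 < r \<Longrightarrow> J (\<lambda>x. r * f x) = r * J f"
    and translate: "f \<in> nonneg_Cc \<Longrightarrow> J (\<lambda>x. f (a + x)) = J f"

lemma exists_invariant_functional:
  fixes f\<^sub>0 :: "'a::{topological_group_add, t2_space} \<Rightarrow> real"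
  assumes lc: "locally_compact_space (euclidean :: 'a topology)"
    and f0: "f\<^sub>0 \<in> nonneg_Cc" "0 < f\<^sub>0 0"
  obtains J :: "('a \<Rightarrow> real) \<Rightarrow> real" where "invariant_functional J" "J f\<^sub>0 = 1"
proof -
  define I where "I \<phi> f = (if f \<in> nonneg_Cc then cover_ratio f \<phi> / cover_ratio f\<^sub>0 \<phi> else 0)"
    for \<phi> f :: "'a \<Rightarrow> real"
  define xs where "xs f = (SOME xs. dominates f\<^sub>0 xs f)" for f
  have xs: "dominates f\<^sub>0 (xs f) f" if "f \<in> nonneg_Cc" for f
    unfolding xs_def using exists_dominates[OF f0 that] by (metis someI)
  define B where "B f = (if f \<in> nonneg_Cc then weight (xs f) else 0)" for f
  have B0: "0 \<le> B f" for f
    using xs[of f] by (simp add: B_def dominates_def weight_nonneg)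
  define X where "X = PiE UNIV (\<lambda>f. {0..B f})"
  have "compactin (product_topology (\<lambda>_. euclidean) UNIV) X"
    unfolding X_def by (subst compactin_PiE) auto
  then have "compact X" by (simp add: euclidean_product_topology)
  define A where "A V = {\<phi> \<in> nonneg_Cc. 0 < \<phi> 0 \<and> (\<forall>x. x \<notin> V \<longrightarrow> \<phi> x = 0)}" for V :: "'a set"
  have fpos: "0 < cover_ratio f\<^sub>0 \<phi>" if "\<phi> \<in> A V" for \<phi> V
    using that cover_ratio_pos[OF _ _ f0] by (auto simp: A_def)
  have IX: "I \<phi> \<in> X" if \<phi>: "\<phi> \<in> A V" for \<phi> V
  proof -
    have "0 \<le> I \<phi> f \<and> I \<phi> f \<le> B f" for f
    proof (cases "f \<in> nonneg_Cc")
      case True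
      have "cover_ratio f \<phi> \<le> weight (xs f) * cover_ratio f\<^sub>0 \<phi>"
        using \<phi> fpos[OF \<phi>] True by (intro cover_ratio_submult f0 xs) (auto simp: A_def)
      moreover have "0 \<le> cover_ratio f \<phi>"
        using \<phi> True by (intro cover_ratio_nonneg) (auto simp: A_def)
      ultimately show ?thesis
        using fpos[OF \<phi>] True by (simp add: I_def B_def field_simps)
    qed (use B0 in \<open>simp add: I_def\<close>)
    then show ?thesis by (auto simp: X_def)
  qed
  have "X \<inter> (\<Inter>V\<in>{V. open V \<and> 0 \<in> V}. closure (I ` A V)) \<noteq> {}"
  proof (rule compact_imp_fip_image[OF \<open>compact X\<close>])
    fix \<V> :: "'a set set" assume \<V>: "finite \<V>" "\<V> \<subseteq> {V. open V \<and> 0 \<in> V}"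
    then have "open (\<Inter>\<V>)" "0 \<in> \<Inter>\<V>" by (auto intro: open_Inter)
    then obtain \<phi> K where "\<phi> \<in> nonneg_Cc" "\<phi> 0 = 1" "compact K" "K \<subseteq> \<Inter>\<V>" "\<And>x. x \<notin> K \<Longrightarrow> \<phi> x = 0"
      using exists_bump[OF lc] by metis
    then have \<phi>: "\<phi> \<in> A (\<Inter>\<V>)" by (auto simp: A_def)
    have "I \<phi> \<in> closure (I ` A V)" if "V \<in> \<V>" for V
      using \<phi> that by (intro subsetD[OF closure_subset] imageI) (auto simp: A_def)
    with IX[OF \<phi>] show "X \<inter> (\<Inter>V\<in>\<V>. closure (I ` A V)) \<noteq> {}"
      by blast
  qed simp
  then obtain J where "J \<in> (\<Inter>V\<in>{V. open V \<and> 0 \<in> V}. closure (I ` A V))"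
    unfolding ex_in_conv[symmetric] by (elim exE IntE)
  then have J: "J \<in> closure (I ` A V)" if "open V" "0 \<in> V" for V using that by simp
  have transfer: "J \<in> C" if "closed C" "open V" "0 \<in> V" "\<And>\<phi>. \<phi> \<in> A V \<Longrightarrow> I \<phi> \<in> C" for C V
    using J[OF that(2,3)] closure_minimal[of "I ` A V" C] that by blast
  have transfer': "J \<in> C" if "closed C" "\<And>\<phi>. \<phi> \<in> A UNIV \<Longrightarrow> I \<phi> \<in> C" for C
    using that by (intro transfer[of C UNIV]) auto
  note cl = closed_Collect_eq closed_Collect_le continuous_on_product_coordinates
    continuous_on_add continuous_on_mult continuous_on_const
  have sub: "J (\<lambda>x. f x + g x) \<le> J f + J g" if f: "f \<in> nonneg_Cc" "g \<in> nonneg_Cc" for f g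
  proof -
    have "J \<in> {J. J (\<lambda>x. f x + g x) \<le> J f + J g}"
    proof (rule transfer')
      fix \<phi> assume \<phi>: "\<phi> \<in> A UNIV"
      then have "cover_ratio (\<lambda>x. f x + g x) \<phi> \<le> cover_ratio f \<phi> + cover_ratio g \<phi>"
        by (intro cover_ratio_subadd f) (auto simp: A_def)
      then show "I \<phi> \<in> {J. J (\<lambda>x. f x + g x) \<le> J f + J g}"
        using fpos[OF \<phi>] f nonneg_Cc_add[OF f]
        by (simp add: I_def add_divide_distrib[symmetric] divide_right_mono)
    qed (intro cl)
    then show ?thesis by simp
  qed
  have super: "J f + J g \<le> J (\<lambda>x. f x + g x)" if f: "f \<in> nonneg_Cc" "g \<in> nonneg_Cc" for f g
  proof -
    obtain h where h: "h \<in> nonneg_Cc"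
      and hV: "\<And>e. 0 < e \<Longrightarrow> \<exists>V. open V \<and> 0 \<in> V \<and> (\<forall>\<phi>\<in>nonneg_Cc. 0 < \<phi> 0 \<longrightarrow> (\<forall>x. x \<notin> V \<longrightarrow> \<phi> x = 0) \<longrightarrow>
         cover_ratio f \<phi> + cover_ratio g \<phi>
           \<le> (1 + e) * (cover_ratio (\<lambda>x. f x + g x) \<phi> + e * cover_ratio h \<phi>))"
      by (rule cover_ratio_superadd_approx[OF f f0]) blast
    have *: "J f + J g \<le> (1 + e) * (J (\<lambda>x. f x + g x) + e * J h)" if e: "0 < e" for e
    proof -
      obtain V where V: "open V" "0 \<in> V" "\<And>\<phi>. \<phi> \<in> A V \<Longrightarrow> cover_ratio f \<phi> + cover_ratio g \<phi>
           \<le> (1 + e) * (cover_ratio (\<lambda>x. f x + g x) \<phi> + e * cover_ratio h \<phi>)"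
        using hV[OF e] by (auto simp: A_def)
      have "J \<in> {J. J f + J g \<le> (1 + e) * (J (\<lambda>x. f x + g x) + e * J h)}"
      proof (rule transfer[OF _ V(1,2)])
        fix \<phi> assume \<phi>: "\<phi> \<in> A V"
        from divide_right_mono[OF V(3)[OF this] less_imp_le[OF fpos[OF this]]]
        show "I \<phi> \<in> {J. J f + J g \<le> (1 + e) * (J (\<lambda>x. f x + g x) + e * J h)}"
          unfolding I_def mem_Collect_eq using f h nonneg_Cc_add[OF f]
          by (simp only: if_True add_divide_distrib[symmetric] times_divide_eq_right)
      qed (intro cl)
      then show ?thesis by (rule CollectD)
    qed
    have "((\<lambda>e. (1 + e) * (J (\<lambda>x. f x + g x) + e * J h)) \<longlongrightarrow> (1 + 0) * (J (\<lambda>x. f x + g x) + 0 * J h))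
        (at_right 0)"
      by (intro tendsto_intros)
    then have "J f + J g \<le> (1 + 0) * (J (\<lambda>x. f x + g x) + 0 * J h)"
      by (rule tendsto_lowerbound) (auto intro!: eventually_mono[OF eventually_at_right_less] *)
    then show ?thesis by simp
  qed
  show ?thesis
  proof (rule that[of J])
    have "J \<in> {J. J f\<^sub>0 = 1}"
      by (rule transfer') (use f0 fpos in \<open>force intro: cl simp: I_def\<close>)+
    then show "J f\<^sub>0 = 1" by simp
    show "invariant_functional J"
    proof
    show "J (\<lambda>x. f x + g x) = J f + J g" if "f \<in> nonneg_Cc" "g \<in> nonneg_Cc" for f g
      using sub super that by (intro antisym)
    show "J f \<le> J g" if "f \<in> nonneg_Cc" "g \<in> nonneg_Cc" "\<And>x. f x \<le> g x" for f g
    proof -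
      have "J \<in> {J. J f \<le> J g}"
      proof (rule transfer')
        fix \<phi> assume \<phi>: "\<phi> \<in> A UNIV"
        then have "cover_ratio f \<phi> \<le> cover_ratio g \<phi>"
          by (intro cover_ratio_mono that) (auto simp: A_def)
        then show "I \<phi> \<in> {J. J f \<le> J g}"
          using fpos[OF \<phi>] that by (simp add: I_def divide_right_mono)
      qed (intro cl)
      then show ?thesis by simp
    qed
    show "J (\<lambda>x. r * f x) = r * J f" if "f \<in> nonneg_Cc" "0 < r" for f r
    proof -
      have "J \<in> {J. J (\<lambda>x. r * f x) = r * J f}"
      proof (rule transfer')
        fix \<phi> assume \<phi>: "\<phi> \<in> A UNIV"
        then have "cover_ratio (\<lambda>x. r * f x) \<phi> = r * cover_ratio f \<phi>"
          by (intro cover_ratio_cmult that) (auto simp: A_def)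
        then show "I \<phi> \<in> {J. J (\<lambda>x. r * f x) = r * J f}"
          using that nonneg_Cc_cmult[of f r] by (simp add: I_def)
      qed (intro cl)
      then show ?thesis by simp
    qed
    show "J (\<lambda>x. f (a + x)) = J f" if "f \<in> nonneg_Cc" for f a
    proof -
      have "J \<in> {J. J (\<lambda>x. f (a + x)) = J f}"
      proof (rule transfer')
        fix \<phi> assume \<phi>: "\<phi> \<in> A UNIV"
        then have "cover_ratio (\<lambda>x. f (a + x)) \<phi> = cover_ratio f \<phi>"
          by (intro cover_ratio_translate that) (auto simp: A_def)
        then show "I \<phi> \<in> {J. J (\<lambda>x. f (a + x)) = J f}"
          using that nonneg_Cc_translate[of f a] by (simp add: I_def)
      qed (intro cl)
      then show ?thesis by simp
    qed
    qed
  qed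
qed

section \<open>Autocorrelations\<close>

context invariant_functional
begin

lemma zero: "J (\<lambda>x. 0) = 0"
  using add[OF nonneg_Cc_zero nonneg_Cc_zero] by simp

lemma nonneg: "f \<in> nonneg_Cc \<Longrightarrow> 0 \<le> J f"
  using mono[OF nonneg_Cc_zero] zero by (simp add: nonneg_Cc_nonneg)

lemma cmult: "f \<in> nonneg_Cc \<Longrightarrow> 0 \<le> r \<Longrightarrow> J (\<lambda>x. r * f x) = r * J f"
  using cmult_pos[of f r] zero by (cases "r = 0") auto

lemma sum_cmult:
  assumes "\<And>i. i \<in> I \<Longrightarrow> h i \<in> nonneg_Cc" "\<And>i. i \<in> I \<Longrightarrow> 0 \<le> r i"
  shows "J (\<lambda>x. \<Sum>i\<in>I. r i * h i x) = (\<Sum>i\<in>I. r i * J (h i))"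
  using assms
proof (induction I rule: infinite_finite_induct)
  case (insert i I)
  have "J (\<lambda>x. r i * h i x + (\<Sum>i\<in>I. r i * h i x)) = J (\<lambda>x. r i * h i x) + J (\<lambda>x. \<Sum>i\<in>I. r i * h i x)"
    using insert by (intro add nonneg_Cc_sum nonneg_Cc_cmult) auto
  then show ?case using insert by (simp add: cmult)
qed (simp_all add: zero)

lemma sum_nonneg:
  assumes "\<And>i. i \<in> I \<Longrightarrow> h i \<in> nonneg_Cc" "\<And>y. 0 \<le> (\<Sum>i\<in>I. r i * h i y)"
  shows "0 \<le> (\<Sum>i\<in>I. r i * J (h i))"
proof -
  define p where "p i = max (r i) 0" for i
  define q where "q i = max (- r i) 0" for i
  have r: "r i = p i - q i" and pq: "0 \<le> p i" "0 \<le> q i" for i by (auto simp: p_def q_def)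
  have "J (\<lambda>x. \<Sum>i\<in>I. q i * h i x) \<le> J (\<lambda>x. \<Sum>i\<in>I. p i * h i x)"
    using assms pq by (intro mono nonneg_Cc_sum nonneg_Cc_cmult)
      (auto simp: r left_diff_distrib sum_subtractf)
  then show ?thesis
    using assms(1) pq by (simp add: sum_cmult r left_diff_distrib sum_subtractf)
qed

lemma correlation_nonneg_Cc:
  assumes "G \<in> nonneg_Cc"
  shows "(\<lambda>y. G (a + y) * G (b + y)) \<in> nonneg_Cc"
  using assms
  by (intro nonneg_Cc_mult nonneg_Cc_translate) (auto simp: nonneg_Cc_nonneg nonneg_Cc_continuous nonneg_Cc_translate)

lemma positive_definite_correlation:
  assumes G: "G \<in> nonneg_Cc"
  shows "positive_definite (\<lambda>x. complex_of_real (J (\<lambda>y. G (- x + y) * G y)))"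
  unfolding positive_definite_def
proof (intro allI)
  fix n :: nat and x :: "nat \<Rightarrow> 'a" and c :: "nat \<Rightarrow> complex"
  define h where "h j k y = G (x k + y) * G (x j + y)" for j k y
  have hP: "h j k \<in> nonneg_Cc" for j k unfolding h_def by (rule correlation_nonneg_Cc[OF G])
  have sym: "h j k = h k j" for j k by (auto simp: h_def)
  have J: "J (\<lambda>y. G (- (x j - x k) + y) * G y) = J (h j k)" for j k
  proof -
    have "J (\<lambda>y. G (- (x j - x k) + (x j + y)) * G (x j + y)) = J (\<lambda>y. G (- (x j - x k) + y) * G y)"
      using correlation_nonneg_Cc[OF G, of "- (x j - x k)" 0] by (intro translate) simp
    moreover have "- (x j - x k) + (x j + y) = x k + y" for y
      by (simp add: diff_conv_add_uminus minus_add add.assoc del: add_uminus_conv_diff)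
    ultimately show ?thesis by (simp add: h_def[abs_def])
  qed
  let ?S = "\<Sum>j=1..n. \<Sum>k=1..n. c j * cnj (c k) * complex_of_real (J (h j k))"
  have "Im ?S = (\<Sum>j=1..n. \<Sum>k=1..n. Im (c j) * Re (c k) * J (h j k))
               - (\<Sum>j=1..n. \<Sum>k=1..n. Re (c j) * Im (c k) * J (h j k))"
    by (simp add: algebra_simps sum_subtractf flip: sum.distrib)
  also have "(\<Sum>j=1..n. \<Sum>k=1..n. Re (c j) * Im (c k) * J (h j k))
           = (\<Sum>j=1..n. \<Sum>k=1..n. Im (c j) * Re (c k) * J (h j k))"
    by (subst sum.swap) (simp add: mult_ac sym)
  finally have im: "Im ?S = 0" by simp
  have "0 \<le> (\<Sum>p\<in>{1..n}\<times>{1..n}. (Re (c (fst p)) * Re (c (snd p)) + Im (c (fst p)) * Im (c (snd p)))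
                 * J (h (fst p) (snd p)))"
  proof (rule sum_nonneg)
    fix y
    have "(\<Sum>p\<in>{1..n}\<times>{1..n}. (Re (c (fst p)) * Re (c (snd p)) + Im (c (fst p)) * Im (c (snd p)))
                 * h (fst p) (snd p) y)
        = (\<Sum>j=1..n. Re (c j) * G (x j + y))\<^sup>2 + (\<Sum>j=1..n. Im (c j) * G (x j + y))\<^sup>2"
      by (simp add: sum.cartesian_product' power2_eq_square sum_product h_def algebra_simps sum.distrib)
    then show "0 \<le> (\<Sum>p\<in>{1..n}\<times>{1..n}. (Re (c (fst p)) * Re (c (snd p)) + Im (c (fst p)) * Im (c (snd p)))
                 * h (fst p) (snd p) y)"
      by simp
  qed (use hP in auto)
  also have "\<dots> = Re ?S"
    by (simp add: sum.cartesian_product')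
  finally show "(\<Sum>j=1..n. \<Sum>k=1..n. c j * cnj (c k) * complex_of_real (J (\<lambda>y. G (- (x j - x k) + y) * G y))) \<in> \<real>\<^sub>\<ge>\<^sub>0"
    unfolding J using im by (simp add: complex_nonneg_Reals_iff)
qed

lemma continuous_correlation:
  assumes G: "G \<in> nonneg_Cc"
  shows "continuous_on UNIV (\<lambda>x. J (\<lambda>y. G (- x + y) * G y))"
  unfolding continuous_on_def
proof (intro ballI tendstoI)
  fix a :: 'a and e :: real assume e: "0 < e"
  define d where "d = e / (J G + 1)"
  have JG: "0 \<le> J G" by (rule nonneg[OF G])
  then have d: "0 < d" and dJ: "d * J G < e" using e by (auto simp: d_def field_simps)
  obtain V where V: "open V" "0 \<in> V" "\<And>y v. v \<in> V \<Longrightarrow> \<bar>G (v + y) - G y\<bar> < d"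
    by (rule nonneg_Cc_right_uniform[OF G d]) blast
  have P: "(\<lambda>y. G (- x + y) * G y) \<in> nonneg_Cc" for x
    using correlation_nonneg_Cc[OF G, of "- x" 0] by simp
  have "open ((\<lambda>x. - x + a) -` V)"
    using V(1) by (intro open_vimage continuous_intros continuous_on_uminus_group)
  then have "\<forall>\<^sub>F x in nhds a. - x + a \<in> V"
    using V(2) by (auto simp: eventually_nhds)
  then have "\<forall>\<^sub>F x in at a within UNIV. - x + a \<in> V"
    by (simp add: eventually_at_filter eventually_mono)
  then show "\<forall>\<^sub>F x in at a within UNIV. dist (J (\<lambda>y. G (- x + y) * G y)) (J (\<lambda>y. G (- a + y) * G y)) < e"
  proof (rule eventually_mono)
    fix x assume "- x + a \<in> V"
    then have "\<bar>G (- x + a + (- a + y)) - G (- a + y)\<bar> < d" for y by (rule V(3))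
    then have G': "\<bar>G (- x + y) - G (- a + y)\<bar> < d" for y by (simp add: add.assoc)
    have *: "J (\<lambda>y. G (- b + y) * G y) \<le> J (\<lambda>y. G (- b' + y) * G y) + d * J G"
      if "\<And>y. \<bar>G (- b + y) - G (- b' + y)\<bar> < d" for b b'
    proof -
      have "J (\<lambda>y. G (- b + y) * G y) \<le> J (\<lambda>y. G (- b' + y) * G y + d * G y)"
      proof (intro mono P nonneg_Cc_add nonneg_Cc_cmult G)
        fix y
        have "G (- b + y) * G y \<le> (G (- b' + y) + d) * G y"
          using that[of y] nonneg_Cc_nonneg[OF G, of y] by (intro mult_right_mono) auto
        then show "G (- b + y) * G y \<le> G (- b' + y) * G y + d * G y"
          by (simp add: distrib_right)
      qed (use d in simp)
      also have "\<dots> = J (\<lambda>y. G (- b' + y) * G y) + d * J G"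
        using d P G by (simp add: add cmult nonneg_Cc_cmult)
      finally show ?thesis .
    qed
    have "\<bar>J (\<lambda>y. G (- x + y) * G y) - J (\<lambda>y. G (- a + y) * G y)\<bar> \<le> d * J G"
      using *[of x a] *[of a x] G' by (simp add: abs_le_iff abs_minus_commute)
    then show "dist (J (\<lambda>y. G (- x + y) * G y)) (J (\<lambda>y. G (- a + y) * G y)) < e"
      using dJ by (simp add: dist_real_def)
  qed
qed

end

section \<open>The upper bound\<close>

lemma funpow_plus_commute: "((+) z ^^ n) 0 + z = z + ((+) z ^^ n) (0::'a::group_add)"
  by (induction n) (simp_all add: add.assoc)

lemma zpow_0 [simp]: "zpow z 0 = 0"
  by (simp add: zpow_def)

lemma zpow_1 [simp]: "zpow z 1 = z"
  by (simp add: zpow_def)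

lemma zpow_minus: "zpow z (- n) = - zpow z n"
  by (auto simp: zpow_def)

lemma zpow_succ: "zpow z (1 + n) = z + zpow z n"
proof (cases "0 \<le> n")
  case True
  then have "nat (1 + n) = Suc (nat n)" by simp
  with True show ?thesis by (simp add: zpow_def)
next
  case False
  then have "nat (- n) = Suc (nat (- (1 + n)))" by simp
  then have "zpow z n = - (z + ((+) z ^^ nat (- (1 + n))) 0)"
    using False by (simp add: zpow_def del: minus_add)
  also have "\<dots> = - (((+) z ^^ nat (- (1 + n))) 0 + z)"
    by (simp only: funpow_plus_commute)
  also have "\<dots> = - z + - ((+) z ^^ nat (- (1 + n))) 0"
    by (rule minus_add)
  also have "- ((+) z ^^ nat (- (1 + n))) 0 = zpow z (1 + n)"
    using False by (cases "n = - 1") (auto simp: zpow_def)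
  finally show ?thesis by (simp only: add_minus_cancel)
qed

lemma zpow_pred: "zpow z (n - 1) = - z + zpow z n"
  using zpow_succ[of z "n - 1"] by simp

lemma zpow_add: "zpow z (m + n) = zpow z m + zpow z n"
proof (induction m rule: int_induct[where k = 0])
  case (step1 i) then show ?case using zpow_succ[of z "i + n"] zpow_succ[of z i] by (simp add: ac_simps add.assoc)
next
  case (step2 i) then show ?case using zpow_pred[of z "i + n"] zpow_pred[of z i] by (simp add: add.assoc algebra_simps)
qed simp

lemma zpow_diff: "zpow z (m - n) = zpow z m - zpow z n"
  using zpow_add[of z m "- n"] by (simp add: zpow_minus)

lemma sum_cis_odd_multiples:
  fixes n :: int and m :: nat
  assumes "\<bar>n\<bar> < int m"
  shows "(\<Sum>k<m. cis (of_int n * ((2 * real k + 1) * pi / real m))) = (if n = 0 then of_nat m else 0)"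
proof (cases "n = 0")
  case False
  have m: "0 < m" using assms by linarith
  define q where "q = cis (of_int n * (2 * pi / real m))"
  have "q \<noteq> 1"
  proof
    assume "q = 1"
    then have "cos (of_int n * (2 * pi / real m)) = 1" by (auto simp: q_def complex_eq_iff)
    then obtain l :: int where "of_int n * (2 * pi / real m) = of_int l * 2 * pi"
      unfolding cos_one_2pi_int by auto
    then have "real_of_int n = real_of_int (l * int m)" using m by (simp add: field_simps)
    then have "n = l * int m" by linarith
    then have "int m \<le> \<bar>n\<bar>" using False by (simp add: abs_mult) (smt (verit) mult_le_cancel_right1 zero_less_abs_iff)
    then show False using assms by simp
  qed
  have "q ^ m = cis (real m * (of_int n * (2 * pi / real m)))"
    unfolding q_def by (rule Complex.DeMoivre)
  also have "\<dots> = cis (2 * pi * of_int n)" using m by (simp add: mult.commute)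
  also have "\<dots> = 1" by (rule cis_multiple_2pi) simp
  finally have "q ^ m = 1" .
  have "cis (of_int n * ((2 * real k + 1) * pi / real m)) = cis (of_int n * (pi / real m)) * q ^ k" for k
    unfolding q_def Complex.DeMoivre cis_mult using m by (intro arg_cong[of _ _ cis]) (simp add: field_simps)
  then have "(\<Sum>k<m. cis (of_int n * ((2 * real k + 1) * pi / real m)))
      = cis (of_int n * (pi / real m)) * (\<Sum>k<m. q ^ k)"
    by (simp add: sum_distrib_left)
  also have "\<dots> = 0" using \<open>q \<noteq> 1\<close> \<open>q ^ m = 1\<close> by (simp add: geometric_sum)
  finally show ?thesis using False by simp
qed simp

definition fejer_weight :: "nat \<Rightarrow> nat \<Rightarrow> real" where
  "fejer_weight m k = cos (pi / real m) - cos ((2 * real k + 1) * pi / real m)"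

lemma fejer_weight_nonneg:
  assumes "k < m"
  shows "0 \<le> fejer_weight m k"
proof -
  have m: "0 < real m" using assms by simp
  have "cos ((2 * real k + 1) * pi / real m) \<le> cos (pi / real m)"
  proof (cases "2 * k + 1 \<le> m")
    case True
    then have "2 * real k + 1 \<le> real m" by linarith
    from mult_right_mono[OF this, of pi] have "(2 * real k + 1) * pi \<le> real m * pi" by simp
    then show ?thesis using m
      by (intro cos_monotone_0_pi_le) (auto simp: field_simps)
  next
    case False
    have "cos ((2 * real k + 1) * pi / real m) = cos (2 * pi - (2 * real k + 1) * pi / real m)"
      by (simp add: cos_diff)
    also have "\<dots> \<le> cos (pi / real m)"
    proof (rule cos_monotone_0_pi_le)
      have "2 * real k + 2 \<le> 2 * real m" "real m \<le> 2 * real k + 1" using assms False by linarith+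
      from mult_right_mono[OF this(1), of pi] mult_right_mono[OF this(2), of pi]
      show "pi / real m \<le> 2 * pi - (2 * real k + 1) * pi / real m"
        "2 * pi - (2 * real k + 1) * pi / real m \<le> pi"
        using m by (auto simp: field_simps)
    qed simp
    finally show ?thesis .
  qed
  then show ?thesis by (simp add: fejer_weight_def)
qed

lemma fejer_weight_sum:
  fixes n :: int and m :: nat
  assumes "\<bar>n\<bar> + 1 < int m" "3 \<le> m"
  shows "(\<Sum>k<m. complex_of_real (fejer_weight m k) * cis (of_int n * ((2 * real k + 1) * pi / real m)))
    = (if n = 0 then of_real (real m * cos (pi / real m)) else if \<bar>n\<bar> = 1 then of_real (- real m / 2) else 0)"
proof -
  define t where "t k = (2 * real k + 1) * pi / real m" for k
  define e where "e n = (\<Sum>k<m. cis (of_int n * t k))" for n :: int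
  have e: "e n = (if n = 0 then of_nat m else 0)" if "\<bar>n\<bar> < int m" for n
    unfolding e_def t_def using sum_cis_odd_multiples[OF that] by simp
  have "complex_of_real (fejer_weight m k) * cis (of_int n * t k)
      = complex_of_real (cos (pi / real m)) * cis (of_int n * t k)
        - cis (of_int (n + 1) * t k) / 2 - cis (of_int (n - 1) * t k) / 2" for k
  proof -
    have shift: "cis (of_int (n + 1) * t k) = cis (of_int n * t k) * cis (t k)"
      "cis (of_int (n - 1) * t k) = cis (of_int n * t k) * cis (- t k)"
      by (simp_all add: cis_mult algebra_simps)
    have cos: "complex_of_real (cos (t k)) = (cis (t k) + cis (- t k)) / 2"
      by (simp add: complex_eq_iff)
    show ?thesis
      unfolding fejer_weight_def t_def[symmetric] of_real_diff shift cos
      by (simp add: algebra_simps add_divide_distrib)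
  qed
  then have "(\<Sum>k<m. complex_of_real (fejer_weight m k) * cis (of_int n * t k))
      = complex_of_real (cos (pi / real m)) * e n - e (n + 1) / 2 - e (n - 1) / 2"
    by (simp add: e_def sum_subtractf sum_distrib_left sum_divide_distrib)
  also have "\<dots> = (if n = 0 then of_real (real m * cos (pi / real m)) else if \<bar>n\<bar> = 1 then of_real (- real m / 2) else 0)"
    using assms e[of n] e[of "n + 1"] e[of "n - 1"] by (auto simp: abs_if split: if_splits)
  finally show ?thesis by (simp add: t_def)
qed

lemma sum_tridiagonal:
  fixes h :: "int \<Rightarrow> complex"
  assumes "\<And>n. 1 < \<bar>n\<bar> \<Longrightarrow> h n = 0"
  shows "(\<Sum>j=1..Suc M. \<Sum>l=1..Suc M. h (int j - int l)) = of_nat (Suc M) * h 0 + of_nat M * (h 1 + h (- 1))"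
proof (induction M)
  case (Suc M)
  have "(\<Sum>l=1..Suc M. h (int (Suc (Suc M)) - int l)) = (\<Sum>l=1..Suc M. if l = Suc M then h 1 else 0)"
    by (intro sum.cong) (auto intro!: assms)
  moreover have "(\<Sum>j=1..Suc M. h (int j - int (Suc (Suc M)))) = (\<Sum>j=1..Suc M. if j = Suc M then h (- 1) else 0)"
    by (intro sum.cong) (auto intro!: assms)
  ultimately have row: "(\<Sum>l=1..Suc M. h (int (Suc (Suc M)) - int l)) = h 1"
    and col: "(\<Sum>j=1..Suc M. h (int j - int (Suc (Suc M)))) = h (- 1)"
    by simp_all
  have "(\<Sum>j=1..Suc (Suc M). \<Sum>l=1..Suc (Suc M). h (int j - int l))
      = (\<Sum>j=1..Suc M. (\<Sum>l=1..Suc M. h (int j - int l)) + h (int j - int (Suc (Suc M))))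
        + ((\<Sum>l=1..Suc M. h (int (Suc (Suc M)) - int l)) + h 0)"
    by (subst (1 2 3) sum.nat_ivl_Suc') (auto simp: add_ac)
  also have "\<dots> = (\<Sum>j=1..Suc M. \<Sum>l=1..Suc M. h (int j - int l)) + h (- 1) + (h 1 + h 0)"
    by (simp only: sum.distrib row col)
  finally show ?case by (simp only: Suc.IH) (simp add: algebra_simps)
qed simp

lemma positive_definite_uminus:
  assumes f: "positive_definite f" "f 0 = 1"
  shows "f (- x) = cnj (f x)"
proof -
  have two: "{1..2::nat} = {1, 2}" by auto
  have *: "(\<Sum>j\<in>{1, 2}. \<Sum>k\<in>{1, 2}. c j * cnj (c k) * f (w j - w k)) \<in> \<real>\<^sub>\<ge>\<^sub>0"
    for c and w :: "nat \<Rightarrow> 'a"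
    using f(1) unfolding positive_definite_def two[symmetric] by blast
  have "Im (f x + f (- x)) = 0"
    using *[of "\<lambda>_. 1" "\<lambda>j. if j = 1 then x else 0"] f(2)
    by (simp add: complex_nonneg_Reals_iff)
  moreover have "Im (- \<i> * f x + \<i> * f (- x)) = 0"
    using *[of "\<lambda>j. if j = 1 then 1 else \<i>" "\<lambda>j. if j = 1 then x else 0"] f(2)
    by (simp add: complex_nonneg_Reals_iff)
  ultimately show ?thesis by (simp add: complex_eq_iff)
qed

lemma positive_definite_cmod_le:
  fixes f :: "'a::group_add \<Rightarrow> complex" and z :: 'a and N :: nat
  assumes f: "positive_definite f" "f 0 = 1" and N: "1 \<le> N"
    and supp: "\<And>n. int N < \<bar>n\<bar> \<Longrightarrow> f (zpow z n) = 0"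
  shows "cmod (f z) \<le> cos (pi / (real N + 2))"
proof -
  define m where "m = N + 2"
  define \<theta> where "\<theta> = - Arg (f z)"
  define t where "t k = (2 * real k + 1) * pi / real m" for k
  define h where "h n = f (zpow z n) * cis (of_int n * \<theta>) *
    (\<Sum>k<m. complex_of_real (fejer_weight m k) * cis (of_int n * t k))" for n :: int
  have W: "(\<Sum>k<m. complex_of_real (fejer_weight m k) * cis (of_int n * t k))
    = (if n = 0 then of_real (real m * cos (pi / real m)) else if \<bar>n\<bar> = 1 then of_real (- real m / 2) else 0)"
    if "\<bar>n\<bar> \<le> int N" for n
    unfolding t_def using that N by (intro fejer_weight_sum) (auto simp: m_def)
  have h_off: "h n = 0" if "1 < \<bar>n\<bar>" for n
    using supp[of n] W[of n] that by (cases "\<bar>n\<bar> \<le> int N") (auto simp: h_def)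
  have h0: "h 0 = of_real (real m * cos (pi / real m))" using W[of 0] f(2) by (simp add: h_def)
  have rot: "f z * cis \<theta> = of_real (cmod (f z))"
    using rcis_cmod_Arg[of "f z"] unfolding \<theta>_def rcis_def
    by (metis cis_mult cis_zero mult.assoc mult.right_neutral right_minus)
  then have h1: "h 1 = of_real (- real m / 2 * cmod (f z))"
    using W[of 1] N by (simp add: h_def)
  have "cnj (f z * cis \<theta>) = of_real (cmod (f z))" unfolding rot by simp
  then have "f (- z) * cis (- \<theta>) = of_real (cmod (f z))"
    by (simp add: positive_definite_uminus[OF f] cis_cnj)
  then have h_1: "h (- 1) = of_real (- real m / 2 * cmod (f z))"
    using W[of "- 1"] N zpow_minus[of z 1] by (simp add: h_def)
  have pos: "0 \<le> real (Suc M) * cos (pi / real m) - real M * cmod (f z)" for M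
  proof -
    define X where "X k j l = cis (real j * (\<theta> + t k)) * cnj (cis (real l * (\<theta> + t k)))
        * f (zpow z (int j) - zpow z (int l))" for k j l
    have X: "(\<Sum>j=1..Suc M. \<Sum>l=1..Suc M. X k j l) \<in> \<real>\<^sub>\<ge>\<^sub>0" for k
      unfolding X_def by (rule f(1)[unfolded positive_definite_def, rule_format])
    have hX: "h (int j - int l) = (\<Sum>k<m. complex_of_real (fejer_weight m k) * X k j l)" for j l
    proof -
      have split: "cis (of_int (int j - int l) * \<theta>) * cis (of_int (int j - int l) * t k)
          = cis (real j * (\<theta> + t k)) * cnj (cis (real l * (\<theta> + t k)))" for k
        by (simp add: cis_cnj cis_mult algebra_simps)
      show ?thesis
        unfolding h_def X_def sum_distrib_left zpow_diff[symmetric]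
        by (intro sum.cong refl) (simp only: split[symmetric] mult_ac)
    qed
    have "(\<Sum>j=1..Suc M. \<Sum>l=1..Suc M. h (int j - int l))
       = (\<Sum>j=1..Suc M. \<Sum>k<m. \<Sum>l=1..Suc M. complex_of_real (fejer_weight m k) * X k j l)"
      unfolding hX by (rule sum.cong[OF refl sum.swap])
    also have "\<dots> = (\<Sum>k<m. \<Sum>j=1..Suc M. \<Sum>l=1..Suc M. complex_of_real (fejer_weight m k) * X k j l)"
      by (rule sum.swap)
    also have "\<dots> = (\<Sum>k<m. complex_of_real (fejer_weight m k) * (\<Sum>j=1..Suc M. \<Sum>l=1..Suc M. X k j l))"
      by (simp only: sum_distrib_left)
    finally have sum_eq: "(\<Sum>j=1..Suc M. \<Sum>l=1..Suc M. h (int j - int l))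
       = (\<Sum>k<m. complex_of_real (fejer_weight m k) * (\<Sum>j=1..Suc M. \<Sum>l=1..Suc M. X k j l))" .
    have Re_mult: "Re (complex_of_real r * w) = r * Re w" for r w by simp
    have "Re (\<Sum>j=1..Suc M. \<Sum>l=1..Suc M. h (int j - int l))
       = (\<Sum>k<m. fejer_weight m k * Re (\<Sum>j=1..Suc M. \<Sum>l=1..Suc M. X k j l))"
      unfolding sum_eq Re_sum[of _ "{..<m}"] Re_mult ..
    also have "0 \<le> \<dots>"
      using X by (intro sum_nonneg mult_nonneg_nonneg fejer_weight_nonneg)
        (auto simp only: complex_nonneg_Reals_iff lessThan_iff)
    finally have "0 \<le> Re (\<Sum>j=1..Suc M. \<Sum>l=1..Suc M. h (int j - int l))" .
    also have "\<dots> = real m * (real (Suc M) * cos (pi / real m) - real M * cmod (f z))"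
      by (subst sum_tridiagonal[OF h_off]) (simp_all add: h0 h1 h_1 algebra_simps)
    finally show ?thesis by (simp add: zero_le_mult_iff m_def)
  qed
  have "cmod (f z) \<le> cos (pi / real m)"
  proof (rule ccontr)
    assume "\<not> ?thesis"
    then have "0 < cmod (f z) - cos (pi / real m)" by simp
    from reals_Archimedean3[OF this] obtain M :: nat
      where "1 < real M * (cmod (f z) - cos (pi / real m))" by blast
    then show False using pos[of M] cos_le_one[of "pi / real m"] by (simp add: algebra_simps)
  qed
  then show ?thesis by (simp add: m_def add.commute)
qed

section \<open>The extremal function\<close>

lemma sin_shift_correlation:
  assumes "0 < m"
  defines "s \<equiv> \<lambda>j. sin (real j * pi / real m)"
  shows "(\<Sum>j\<in>{1..<m}. s j * s (Suc j)) = cos (pi / real m) * (\<Sum>j\<in>{1..<m}. (s j)\<^sup>2)"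
proof -
  obtain n where m: "m = Suc n" using assms(1) by (cases m) auto
  have s0: "s 0 = 0" and sm: "s (Suc n) = 0" using m by (simp_all add: s_def)
  have rec: "s j + s (Suc (Suc j)) = 2 * cos (pi / real m) * s (Suc j)" for j
  proof -
    have "real (Suc j) * pi / real m - pi / real m = real j * pi / real m"
      "real (Suc j) * pi / real m + pi / real m = real (Suc (Suc j)) * pi / real m"
      by (simp_all add: add_divide_distrib distrib_right)
    then show ?thesis
      using sin_diff[of "real (Suc j) * pi / real m" "pi / real m"]
        sin_add[of "real (Suc j) * pi / real m" "pi / real m"]
      unfolding s_def by simp
  qed
  have iv: "(\<Sum>j\<in>{1..<m}. g j) = (\<Sum>j<n. g (Suc j))" for g :: "nat \<Rightarrow> real"
    unfolding m by (simp add: sum.atLeast1_atMost_eq atLeastLessThanSuc_atLeastAtMost)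
  have "(\<Sum>j<n. s (Suc j) * s (Suc (Suc j))) = (\<Sum>j<Suc n. s j * s (Suc j))"
    by (subst sum.lessThan_Suc_shift) (simp add: s0)
  also have "\<dots> = (\<Sum>j<n. s j * s (Suc j))" by (simp add: sm)
  finally have "2 * (\<Sum>j<n. s (Suc j) * s (Suc (Suc j))) = (\<Sum>j<n. s (Suc j) * (s j + s (Suc (Suc j))))"
    by (simp add: distrib_left sum.distrib mult.commute)
  also have "\<dots> = 2 * (cos (pi / real m) * (\<Sum>j<n. (s (Suc j))\<^sup>2))"
    unfolding rec by (simp add: sum_distrib_left power2_eq_square mult_ac)
  finally show ?thesis unfolding iv by simp
qed

lemma exists_small_neighbourhood:
  fixes \<Omega> :: "'a::{topological_group_add, t2_space} set"
  assumes "open \<Omega>" "finite A" "finite B"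
    and \<Omega>: "\<And>a b. (a, b) \<in> A \<Longrightarrow> a - b \<in> \<Omega>" and B: "0 \<notin> B"
  obtains V where "open V" "0 \<in> V"
    "\<And>a b x y. (a, b) \<in> A \<Longrightarrow> x \<in> V \<Longrightarrow> y \<in> V \<Longrightarrow> a + y - x - b \<in> \<Omega>"
    "\<And>x y. x \<in> V \<Longrightarrow> y \<in> V \<Longrightarrow> x - y \<notin> B"
proof -
  define P where "P p \<longleftrightarrow> (\<forall>q\<in>A. fst q + snd p - fst p - snd q \<in> \<Omega>) \<and> fst p - snd p \<notin> B" for p
  have "\<forall>\<^sub>F p in nhds (0, 0). fst q + snd p - fst p - snd q \<in> \<Omega>" if "q \<in> A" for q
  proof -
    let ?U = "(\<lambda>p. fst q + snd p - fst p - snd q) -` \<Omega>"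
    have "open ?U"
      by (intro open_vimage assms(1) continuous_on_diff_group continuous_intros)
    moreover have "(0, 0) \<in> ?U" using \<Omega>[of "fst q" "snd q"] that by simp
    ultimately show ?thesis unfolding eventually_nhds by blast
  qed
  then have "\<forall>\<^sub>F p in nhds (0, 0). \<forall>q\<in>A. fst q + snd p - fst p - snd q \<in> \<Omega>"
    using assms(2) by (simp add: eventually_ball_finite)
  moreover have "\<forall>\<^sub>F p in nhds (0, 0). fst p - snd p \<notin> B"
  proof -
    let ?U = "(\<lambda>p. fst p - snd p) -` (- B)"
    have "open ?U"
      using assms(3) by (intro open_vimage continuous_on_diff_group continuous_intros) (simp add: finite_imp_closed open_Compl)
    moreover have "(0, 0) \<in> ?U" using B by simp
    ultimately show ?thesis unfolding eventually_nhds by blast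
  qed
  ultimately have "eventually P (nhds 0 \<times>\<^sub>F nhds 0)"
    unfolding P_def nhds_prod by (rule eventually_conj)
  then obtain Q where Q: "eventually Q (nhds 0)" "\<forall>x y. Q x \<longrightarrow> Q y \<longrightarrow> P (x, y)"
    unfolding eventually_prod_same by (elim exE conjE)
  then obtain V where "open V" "0 \<in> V" "\<forall>x\<in>V. Q x"
    unfolding eventually_nhds by (elim exE conjE)
  with Q(2) show ?thesis
    by (intro that[of V]) (force simp: P_def)+
qed

lemma exists_extremal_function:
  fixes \<Omega> :: "'a::{topological_group_add, t2_space} set"
  assumes lc: "locally_compact_space (euclidean :: 'a topology)" and "open \<Omega>"
    and \<Omega>: "\<And>n. \<bar>n\<bar> \<le> int N \<Longrightarrow> zpow z n \<in> \<Omega>" and z: "infinite_order z"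
  obtains f where "f \<in> F_c_real \<Omega>" "f z = of_real (cos (pi / (real N + 2)))"
proof -
  define m where "m = N + 2"
  define Z where "Z j = zpow z (int j)" for j
  define I where "I = {1..<m}"
  have Z_inj: "zpow z n \<noteq> 0" if "n \<noteq> 0" for n
    using z that zpow_minus[of z n] unfolding infinite_order_def
    by (metis linorder_neqE_linordered_idom neg_0_less_iff_less neg_equal_0_iff_equal)

  have finI: "finite I" by (simp add: I_def)
  define A where "A = (\<lambda>(k, i). (Z k, Z i)) ` (I \<times> I)"
  define B where "B = zpow z ` ({- int m..int m} - {0})"
  have A: "a - b \<in> \<Omega>" if "(a, b) \<in> A" for a b
  proof -
    from that obtain k i where "a = Z k" "b = Z i" "k \<in> I" "i \<in> I" by (auto simp: A_def)
    then show ?thesis using \<Omega>[of "int k - int i"] by (auto simp: Z_def zpow_diff I_def m_def)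
  qed
  have B: "0 \<notin> B" using Z_inj unfolding B_def by (metis DiffE imageE singletonI)
  have fin: "finite A" "finite B" using finI by (auto simp: A_def B_def)
  obtain V where V: "open V" "0 \<in> V"
      "\<And>a b x y. (a, b) \<in> A \<Longrightarrow> x \<in> V \<Longrightarrow> y \<in> V \<Longrightarrow> a + y - x - b \<in> \<Omega>"
      "\<And>x y. x \<in> V \<Longrightarrow> y \<in> V \<Longrightarrow> x - y \<notin> B"
    by (rule exists_small_neighbourhood[OF assms(2) fin A B]) (assumption | rule that)+
  obtain \<phi> K where \<phi>: "\<phi> \<in> nonneg_Cc" "\<phi> 0 = 1" and K: "compact K" "K \<subseteq> V" "\<And>x. x \<notin> K \<Longrightarrow> \<phi> x = 0"
    by (rule exists_bump[OF lc V(1,2)]) (rule that)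
  have "(\<lambda>x. \<phi> x * \<phi> x) \<in> nonneg_Cc"
    using \<phi>(1) by (intro nonneg_Cc_mult) (auto simp: nonneg_Cc_nonneg nonneg_Cc_continuous)
  then obtain J where "invariant_functional J" and J1: "J (\<lambda>x. \<phi> x * \<phi> x) = 1"
    using exists_invariant_functional[OF lc, of "\<lambda>x. \<phi> x * \<phi> x"] \<phi>(2) by auto
  then interpret invariant_functional J by simp
  define T where "T i y = \<phi> (- Z i + y)" for i y
  have T: "T i \<in> nonneg_Cc" for i unfolding T_def by (rule nonneg_Cc_translate[OF \<phi>(1)])
  have TT: "(\<lambda>y. T i y * T k y) \<in> nonneg_Cc" for i k
    using T by (intro nonneg_Cc_mult) (auto simp: nonneg_Cc_nonneg nonneg_Cc_continuous)
  have orth: "J (\<lambda>y. T i y * T k y) = (if i = k then 1 else 0)" if "i \<le> m" "k \<le> m" for i k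
  proof (cases "i = k")
    case True
    have "J (\<lambda>y. T k y * T k y) = J (\<lambda>y. \<phi> y * \<phi> y)"
      unfolding T_def using \<open>(\<lambda>x. \<phi> x * \<phi> x) \<in> nonneg_Cc\<close> by (rule translate)
    then show ?thesis using True J1 by simp
  next
    case False
    have "T i y * T k y = 0" for y
    proof (rule ccontr)
      assume "\<not> ?thesis"
      then have "- Z i + y \<in> K" "- Z k + y \<in> K" using K(3) by (auto simp: T_def)
      then have "(- Z i + y) - (- Z k + y) \<notin> B"
        using K(2) by (intro V(4)) auto
      moreover have "- int i + int k \<in> {- int m..int m} - {0}"
        using that False by auto
      ultimately have "(- Z i + y) - (- Z k + y) \<noteq> zpow z (- int i + int k)"
        unfolding B_def by blast
      moreover have "(- Z i + y) - (- Z k + y) = - Z i + Z k"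
        by (simp add: diff_conv_add_uminus minus_add add.assoc del: add_uminus_conv_diff)
      ultimately show False by (simp only: zpow_add zpow_minus Z_def)
    qed
    then have "(\<lambda>y. T i y * T k y) = (\<lambda>_. 0)" by (rule ext)
    then show ?thesis using False zero by (simp only: if_False)
  qed

  define s where "s j = sin (real j * pi / real m)" for j
  define c where "c = (\<Sum>j\<in>I. (s j)\<^sup>2)"
  have s0: "0 \<le> s j" if "j \<in> I" for j
    using that unfolding s_def I_def
    by (intro sin_ge_zero) (auto simp: divide_le_eq mult.commute intro!: mult_left_mono)
  have "0 < s 1" unfolding s_def by (rule sin_gt_zero) (auto simp: m_def field_simps intro!: add_pos_nonneg)
  then have "0 < (s 1)\<^sup>2" by simp
  also have "\<dots> \<le> c" unfolding c_def by (rule member_le_sum) (auto simp: I_def m_def)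
  finally have c: "0 < c" .
  define b where "b j = s j / sqrt c" for j
  have b0: "0 \<le> b j" if "j \<in> I" for j using s0[OF that] c by (simp add: b_def)
  have bb: "b i * b j = s i * s j / c" for i j using c by (simp add: b_def)
  define G where "G y = (\<Sum>j\<in>I. b j * T j y)" for y
  have G: "G \<in> nonneg_Cc"
    unfolding G_def using b0 T by (intro nonneg_Cc_sum nonneg_Cc_cmult)
  define f where "f x = complex_of_real (J (\<lambda>y. G (- x + y) * G y))" for x
  have f_zpow: "J (\<lambda>y. G (- Z r + y) * G y) = (\<Sum>p\<in>I \<times> I. b (fst p) * b (snd p) * (if fst p + r = snd p then 1 else 0))"
    if r: "r \<le> 1" for r
  proof -
    have shift: "T j (- Z r + y) = T (j + r) y" for j y
    proof -
      have "Z (j + r) = Z (r + j)" by (simp add: add.commute)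
      then have "- Z j + (- Z r + y) = - Z (j + r) + y"
        by (simp add: Z_def zpow_add minus_add add.assoc del: add_uminus_conv_diff)
      then show ?thesis by (simp add: T_def)
    qed
    have "G (- Z r + y) * G y = (\<Sum>p\<in>I \<times> I. (b (fst p) * b (snd p)) * (T (fst p + r) y * T (snd p) y))" for y
      unfolding G_def shift sum_product sum.cartesian_product' fst_conv snd_conv
      by (intro sum.cong refl) (simp only: mult_ac)
    then have "J (\<lambda>y. G (- Z r + y) * G y)
        = J (\<lambda>y. \<Sum>p\<in>I \<times> I. (b (fst p) * b (snd p)) * (T (fst p + r) y * T (snd p) y))"
      by simp
    also have "\<dots> = (\<Sum>p\<in>I \<times> I. (b (fst p) * b (snd p)) * J (\<lambda>y. T (fst p + r) y * T (snd p) y))"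
      by (rule sum_cmult[of "I \<times> I" "\<lambda>p y. T (fst p + r) y * T (snd p) y"]) (use TT b0 in auto)
    also have "\<dots> = (\<Sum>p\<in>I \<times> I. b (fst p) * b (snd p) * (if fst p + r = snd p then 1 else 0))"
      using r by (intro sum.cong refl arg_cong2[of _ _ _ _ "(*)"] orth) (auto simp: I_def)
    finally show ?thesis .
  qed
  have "J (\<lambda>y. G (- Z 0 + y) * G y) = (\<Sum>j\<in>I. b j * b j)"
    unfolding f_zpow[OF zero_le_one]
    by (simp add: sum.cartesian_product' if_distrib[of "\<lambda>x. _ * x"] I_def cong: if_cong)
  also have "\<dots> = c / c"
    unfolding bb sum_divide_distrib[symmetric] by (simp only: c_def power2_eq_square)
  finally have f0: "f 0 = 1" using c by (simp add: f_def Z_def)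
  have "J (\<lambda>y. G (- Z 1 + y) * G y) = (\<Sum>j\<in>I. if Suc j \<in> I then b j * b (Suc j) else 0)"
    unfolding f_zpow[OF order_refl]
    by (simp add: sum.cartesian_product' if_distrib[of "\<lambda>x. _ * x"] I_def cong: if_cong)
  also have "\<dots> = (\<Sum>j\<in>I. b j * b (Suc j))"
    by (intro sum.cong) (auto simp: I_def b_def s_def less_Suc_eq m_def)
  also have "\<dots> = cos (pi / real m) * c / c"
    using sin_shift_correlation[of m] unfolding bb sum_divide_distrib[symmetric]
    by (simp add: m_def c_def I_def s_def)
  finally have fz: "f z = of_real (cos (pi / (real N + 2)))"
    using c by (simp add: f_def Z_def m_def add.commute)

  define S where "S i k p = Z k + snd p - fst p - Z i" for i k :: nat and p :: "'a \<times> 'a"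
  define L where "L = (\<Union>i\<in>I. \<Union>k\<in>I. S i k ` (K \<times> K))"
  have "continuous_on A (S i k)" for A i k
    unfolding S_def by (intro continuous_on_diff_group continuous_intros)
  then have "compact L"
    unfolding L_def using K(1) finI
    by (intro compact_UN compact_continuous_image compact_Times)
  have "L \<subseteq> \<Omega>"
  proof
    fix x assume "x \<in> L"
    then obtain i k p where p: "i \<in> I" "k \<in> I" "p \<in> K \<times> K" "x = S i k p" unfolding L_def by blast
    then have "(Z k, Z i) \<in> A" unfolding A_def by force
    with p K(2) show "x \<in> \<Omega>" by (auto simp: S_def intro!: V(3))
  qed
  have off: "f x = 0" if "x \<notin> L" for x
  proof -
    have "G (- x + y) * G y = 0" for y
    proof (rule ccontr)
      assume "\<not> ?thesis"
      then have "G (- x + y) \<noteq> 0" "G y \<noteq> 0" by auto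
      moreover have "\<exists>i\<in>I. T i w \<noteq> 0" if "G w \<noteq> 0" for w
        using sum.not_neutral_contains_not_neutral[OF that[unfolded G_def]] by auto
      ultimately obtain i k where ik: "i \<in> I" "k \<in> I" "T i (- x + y) \<noteq> 0" "T k y \<noteq> 0"
        by blast
      then have "- Z i + (- x + y) \<in> K" "- Z k + y \<in> K" using K(3) by (auto simp: T_def)
      moreover have "x = S i k (- Z i + (- x + y), - Z k + y)"
        by (simp add: S_def diff_conv_add_uminus minus_add add.assoc del: add_uminus_conv_diff)
      ultimately show False using that ik(1,2) unfolding L_def by blast
    qed
    then have "(\<lambda>y. G (- x + y) * G y) = (\<lambda>_. 0)" by (rule ext)
    then show ?thesis unfolding f_def by (simp only: zero of_real_0)
  qed
  then have "closed_support f \<subseteq> L"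
    unfolding closed_support_def using \<open>compact L\<close>
    by (intro closure_minimal compact_imp_closed) auto
  then have "compact (closed_support f)"
    using \<open>compact L\<close> by (metis closed_support_def closed_closure compact_Int_closed inf.absorb_iff2)
  moreover have "continuous_on UNIV f"
    unfolding f_def by (intro continuous_on_of_real continuous_correlation[OF G])
  moreover have "positive_definite f"
    unfolding f_def by (rule positive_definite_correlation[OF G])
  ultimately have "f \<in> F_c_real \<Omega>"
    using f0 \<open>closed_support f \<subseteq> L\<close> \<open>L \<subseteq> \<Omega>\<close> by (auto simp: F_c_real_def F_c_def f_def)
  with fz show ?thesis by (rule that[rotated])
qed

theorem theorem9:
  fixes \<Omega> :: "'a::{topological_group_add, t2_space} set"
    and z :: 'a and N :: nat
  assumes "locally_compact_space (euclidean :: 'a topology)"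
    and "open \<Omega>" and "0 \<in> \<Omega>" and "uminus ` \<Omega> = \<Omega>"
    and "z \<in> \<Omega>" and "infinite_order z"
    and "cyclic_subgroup z \<inter> \<Omega> = {zpow z n | n. - int N \<le> n \<and> n \<le> int N}"
  shows "C_c \<Omega> z = cos (pi / (real N + 2)) \<and>
         C_sharp \<Omega> z = cos (pi / (real N + 2)) \<and>
         K_c \<Omega> z = cos (pi / (real N + 2)) \<and>
         K_sharp \<Omega> z = cos (pi / (real N + 2))"
proof -
  have inj: "m = n" if "zpow z m = zpow z n" for m n
  proof (rule ccontr)
    assume "m \<noteq> n"
    then have "0 < m - n \<or> 0 < n - m" by linarith
    moreover have "zpow z (m - n) = 0" "zpow z (n - m) = 0" using that by (simp_all add: zpow_diff)
    ultimately show False using assms(6) unfolding infinite_order_def by blast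
  qed
  have mem: "zpow z n \<in> \<Omega> \<longleftrightarrow> \<bar>n\<bar> \<le> int N" for n
  proof
    assume "zpow z n \<in> \<Omega>"
    then have "zpow z n \<in> {zpow z n | n. - int N \<le> n \<and> n \<le> int N}"
      unfolding assms(7)[symmetric] cyclic_subgroup_def by blast
    then show "\<bar>n\<bar> \<le> int N" using inj by fastforce
  next
    assume "\<bar>n\<bar> \<le> int N"
    then have "zpow z n \<in> {zpow z n | n. - int N \<le> n \<and> n \<le> int N}" by force
    then show "zpow z n \<in> \<Omega>" unfolding assms(7)[symmetric] by blast
  qed
  have N: "1 \<le> N" using mem[of 1] assms(5) by simp
  have upper: "cmod (f z) \<le> cos (pi / (real N + 2))" if "f \<in> F_sharp \<Omega>" for f
    using that mem N by (intro positive_definite_cmod_le) (auto simp: F_sharp_def)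
  obtain g where g: "g \<in> F_c_real \<Omega>" "g z = of_real (cos (pi / (real N + 2)))"
    using exists_extremal_function[OF assms(1,2) _ assms(6)] mem by metis
  have "0 \<le> cos (pi / (real N + 2))"
    by (rule cos_ge_zero) (auto simp: field_simps intro: order_trans[of _ 0])
  then have gz: "cmod (g z) = cos (pi / (real N + 2))" using g(2) by (simp only: norm_of_real abs_of_nonneg)
  have sup: "Sup {cmod (f z) | f. f \<in> A} = cos (pi / (real N + 2))" if "g \<in> A" "A \<subseteq> F_sharp \<Omega>" for A
    using that gz upper by (intro cSup_eq_maximum) (auto intro!: exI[of _ g])
  have c_sharp: "F_c \<Omega> \<subseteq> F_sharp \<Omega>"
  proof
    fix f assume f: "f \<in> F_c \<Omega>"
    have "{x. f x \<noteq> 0} \<subseteq> closed_support f"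
      unfolding closed_support_def by (rule closure_subset)
    with f have "x \<notin> \<Omega> \<Longrightarrow> f x = 0" for x by (auto simp: F_c_def)
    with f show "f \<in> F_sharp \<Omega>" by (simp add: F_c_def F_sharp_def)
  qed
  then have c_sharp_real: "F_c_real \<Omega> \<subseteq> F_sharp_real \<Omega>"
    by (auto simp: F_c_real_def F_sharp_real_def)
  have "F_c_real \<Omega> \<subseteq> F_c \<Omega>" "F_sharp_real \<Omega> \<subseteq> F_sharp \<Omega>"
    by (auto simp: F_c_real_def F_sharp_real_def)
  with c_sharp c_sharp_real g(1) show ?thesis
    unfolding C_c_def C_sharp_def K_c_def K_sharp_def by (intro conjI sup) blast+
qed

end
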